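(* Let $A$, $G$, $H$ be left-orderable groups with fixed embeddings $A\hookrightarrow G$ and $A\hookrightarrow H$, by which $A$ is regarded as a common subgroup of $G$ and $H$. Let $<_G$ and $<_H$ be discrete left-orderings of $G$ and $H$ respectively, such that: (a) the restrictions of $<_G$ and $<_H$ to $A$ yield the same left-ordering $<_A$ of $A$; (b) $A$ is a stepping with respect to both $<_G$ and $<_H$; (c) $<_G$ is isolated, and $<_H$ is relatively isolated with respect to $A$. Let $a_{\sf min}$, $g_{\sf min}$, $h_{\sf min}$ denote the minimal positive elements of $<_A$, $<_G$, $<_H$ respectively. Then the amalgamated free product $X=G*_A H$ admits isolated left-orderings $<_X^{(1)}$ and $<_X^{(2)}$ with the following properties: (1) Both extend $<_G$ and $<_H$: for $i=1,2$, if $g<_G g'$ $(g,g'\in G)$ then $g<_X^{(i)}g'$, and if $h<_H h'$ $(h,h'\in H)$ then $h<_X^{(i)}h'$. (2) If $\{g_1,\dots,g_m\}$ is a characteristic positive set of $<_G$ and $\{h_1,\dots,h_n\}$ is a characteristic positive set of $<_H$ relative to $A$, then $\{g_1,\dots,g_m,h_1,\dots,h_n,\,h_{\sf min}a_{\sf min}^{-1}g_{\sf min}\}$ is a characteristic positive set of $<_X^{(1)}$, and $\{g_1,\dots,g_m,h_1,\dots,h_n,\,g_{\sf min}a_{\sf min}^{-1}h_{\sf min}\}$ is a characteristic positive set of $<_X^{(2)}$. (3) $<_X^{(1)}$ is discrete with minimal positive element $h_{\sf min}a_{\sf min}^{-1}g_{\sf min}$, and $<_X^{(2)}$ is discrete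 with minimal positive element $g_{\sf min}a_{\sf min}^{-1}h_{\sf min}$. (4) $A$ is a stepping with respect to both $<_X^{(1)}$ and $<_X^{(2)}$.
   Context: A left-ordering of a group $G$ is a total ordering $<_G$ on $G$ such that $a<_G b$ implies $ga<_G gb$ for all $a,b,g\in G$; $G$ is left-orderable if it admits one. A left-ordering is discrete if there is a minimal element among the elements $g$ with $1<_G g$; this element is called the minimal positive element. $\mathrm{LO}(G)$ is the set of left-orderings of $G$, with the topology having as open sub-basis the sets $U_g=\{<_G\in \mathrm{LO}(G) : 1<_G g\}$, $g\in G$. A left-ordering is isolated if it is an isolated point of $\mathrm{LO}(G)$; equivalently, there is a finite set $\{g_1,\dots,g_n\}\subset G$ with $\bigcap_{i=1}^n U_{g_i}=\{<_G\}$. Such a finite set is called a characteristic positive set of $<_G$. For a subgroup $A\subset G$, let $\mathsf{Res}:\mathrm{LO}(G)\to \mathrm{LO}(A)$ be the restriction map. $<_G$ is relatively isolated with respect to $A$ if it is an isolated point of the subspace $\mathsf{Res}^{-1}(\mathsf{Res}(<_G))\subset \mathrm{LO}(G)$; equivalently, there is a finite set $\{g_1,\dots,g_n\}\subset G$ with $\mathsf{Res}^{-1}(\mathsf{Res}(<_G))\cap\bigcap_{i=1}^n U_{g_i}=\{<_G\}$. Such a finite set is called a characteristic positive set of $<_G$ relative to $A$. A subgroup $A\subset G$ is a stepping with respect to a left-ordering $<_G$ of $G$ if for each $g\in G$ both $\max_{<_G}\{a\in A: a\le_G g\}$ and $\min_{<_G}\{a\in A: g<_G a\}$ exist. If $A$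 is a stepping with respect to $<_G$, then the restriction $<_A$ of $<_G$ to $A$ is discrete, so $a_{\sf min}$ exists. *)

theory Defs
  imports "HOL-Analysis.Abstract_Topology" "HOL-Algebra.Group"
begin

section \<open>Left-orderings\<close>

text \<open>
  A left-ordering is the set of pairs of its strict part. Requiring it to be contained in
  \<open>carrier G \<times> carrier G\<close> makes equality of relations the same as equality of orderings.
\<close>

definition LO :: "('a, 'm) monoid_scheme \<Rightarrow> 'a rel set" where
  "LO G = {r. r \<subseteq> carrier G \<times> carrier G \<and> strict_linear_order_on (carrier G) r \<and>
     (\<forall>a b g. (a, b) \<in> r \<longrightarrow> g \<in> carrier G \<longrightarrow> (g \<otimes>\<^bsub>G\<^esub> a, g \<otimes>\<^bsub>G\<^esub> b) \<in> r)}"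

definition left_orderable :: "('a, 'm) monoid_scheme \<Rightarrow> bool" where
  "left_orderable G \<longleftrightarrow> group G \<and> LO G \<noteq> {}"

definition is_min_positive :: "('a, 'm) monoid_scheme \<Rightarrow> 'a rel \<Rightarrow> 'a \<Rightarrow> bool" where
  "is_min_positive G r p \<longleftrightarrow> (\<one>\<^bsub>G\<^esub>, p) \<in> r \<and> (\<forall>g. (\<one>\<^bsub>G\<^esub>, g) \<in> r \<longrightarrow> (p, g) \<in> r\<^sup>=)"

definition discrete_ordering :: "('a, 'm) monoid_scheme \<Rightarrow> 'a rel \<Rightarrow> bool" where
  "discrete_ordering G r \<longleftrightarrow> (\<exists>p. is_min_positive G r p)"

definition min_positive :: "('a, 'm) monoid_scheme \<Rightarrow> 'a rel \<Rightarrow> 'a" where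
  "min_positive G r = (THE p. is_min_positive G r p)"

definition LO_pos :: "('a, 'm) monoid_scheme \<Rightarrow> 'a \<Rightarrow> 'a rel set" where
  "LO_pos G g = {r \<in> LO G. (\<one>\<^bsub>G\<^esub>, g) \<in> r}"

text \<open>
  The whole space is added to the sub-basis because \<open>topology_generated_by\<close> takes the union of
  the generating sets, not the empty intersection, as the space; this matters only if \<open>G\<close> is
  trivial.
\<close>

definition LO_topology :: "('a, 'm) monoid_scheme \<Rightarrow> 'a rel topology" where
  "LO_topology G = topology_generated_by (insert (LO G) (LO_pos G ` carrier G))"

lemma topspace_LO_topology: "topspace (LO_topology G) = LO G"
  by (auto simp: LO_topology_def LO_pos_def)

definition isolated_ordering :: "('a, 'm) monoid_scheme \<Rightarrow> 'a rel \<Rightarrow> bool" where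
  "isolated_ordering G r \<longleftrightarrow> openin (LO_topology G) {r}"

definition characteristic_positive_set ::
    "('a, 'm) monoid_scheme \<Rightarrow> 'a rel \<Rightarrow> 'a set \<Rightarrow> bool" where
  "characteristic_positive_set G r P \<longleftrightarrow>
     finite P \<and> P \<subseteq> carrier G \<and> LO G \<inter> (\<Inter>g\<in>P. LO_pos G g) = {r}"

text \<open>\<open>Res_fibre G B r\<close> is the preimage under \<open>Res : LO(G) \<rightarrow> LO(B)\<close> of the restriction of \<open>r\<close>.\<close>

definition Res_fibre :: "('a, 'm) monoid_scheme \<Rightarrow> 'a set \<Rightarrow> 'a rel \<Rightarrow> 'a rel set" where
  "Res_fibre G B r = {s \<in> LO G. Restr s B = Restr r B}"

definition relatively_isolated_ordering ::
    "('a, 'm) monoid_scheme \<Rightarrow> 'a set \<Rightarrow> 'a rel \<Rightarrow> bool" where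
  "relatively_isolated_ordering G B r \<longleftrightarrow>
     openin (subtopology (LO_topology G) (Res_fibre G B r)) {r}"

definition relative_characteristic_positive_set ::
    "('a, 'm) monoid_scheme \<Rightarrow> 'a set \<Rightarrow> 'a rel \<Rightarrow> 'a set \<Rightarrow> bool" where
  "relative_characteristic_positive_set G B r P \<longleftrightarrow>
     finite P \<and> P \<subseteq> carrier G \<and> Res_fibre G B r \<inter> (\<Inter>g\<in>P. LO_pos G g) = {r}"

definition stepping :: "('a, 'm) monoid_scheme \<Rightarrow> 'a rel \<Rightarrow> 'a set \<Rightarrow> bool" where
  "stepping G r B \<longleftrightarrow> subgroup B G \<and> (\<forall>g\<in>carrier G.
     (\<exists>m\<in>B. (m, g) \<in> r\<^sup>= \<and> (\<forall>a\<in>B. (a, g) \<in> r\<^sup>= \<longrightarrow> (a, m) \<in> r\<^sup>=)) \<and>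
     (\<exists>m\<in>B. (g, m) \<in> r \<and> (\<forall>a\<in>B. (g, a) \<in> r \<longrightarrow> (m, a) \<in> r\<^sup>=)))"


section \<open>Amalgamated free products\<close>

text \<open>
  The amalgamated free product of \<open>G\<close> and \<open>H\<close> along \<open>i : A \<rightarrow> G\<close> and \<open>j : A \<rightarrow> H\<close> is the monoid
  of words over the disjoint union of \<open>G\<close> and \<open>H\<close> modulo the congruence generated by the
  multiplication tables of \<open>G\<close> and \<open>H\<close> and the identification of \<open>i a\<close> with \<open>j a\<close>. Since letters
  become invertible in the quotient, no formal inverses are needed.
\<close>

abbreviation amalg_words ::
    "('g, 'm) monoid_scheme \<Rightarrow> ('h, 'n) monoid_scheme \<Rightarrow> ('g + 'h) list set" where
  "amalg_words G H \<equiv> lists (carrier G <+> carrier H)"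

inductive_set amalg_rel ::
    "('a, 'l) monoid_scheme \<Rightarrow> ('g, 'm) monoid_scheme \<Rightarrow> ('h, 'n) monoid_scheme \<Rightarrow>
     ('a \<Rightarrow> 'g) \<Rightarrow> ('a \<Rightarrow> 'h) \<Rightarrow> ('g + 'h) list rel"
  for A G H i j
where
  refl: "w \<in> amalg_words G H \<Longrightarrow> (w, w) \<in> amalg_rel A G H i j"
| sym: "(v, w) \<in> amalg_rel A G H i j \<Longrightarrow> (w, v) \<in> amalg_rel A G H i j"
| trans: "(u, v) \<in> amalg_rel A G H i j \<Longrightarrow> (v, w) \<in> amalg_rel A G H i j \<Longrightarrow>
    (u, w) \<in> amalg_rel A G H i j"
| append: "(u, u') \<in> amalg_rel A G H i j \<Longrightarrow> (v, v') \<in> amalg_rel A G H i j \<Longrightarrow>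
    (u @ v, u' @ v') \<in> amalg_rel A G H i j"
| one_left: "([Inl \<one>\<^bsub>G\<^esub>], []) \<in> amalg_rel A G H i j"
| one_right: "([Inr \<one>\<^bsub>H\<^esub>], []) \<in> amalg_rel A G H i j"
| mult_left: "g \<in> carrier G \<Longrightarrow> g' \<in> carrier G \<Longrightarrow>
    ([Inl g, Inl g'], [Inl (g \<otimes>\<^bsub>G\<^esub> g')]) \<in> amalg_rel A G H i j"
| mult_right: "h \<in> carrier H \<Longrightarrow> h' \<in> carrier H \<Longrightarrow>
    ([Inr h, Inr h'], [Inr (h \<otimes>\<^bsub>H\<^esub> h')]) \<in> amalg_rel A G H i j"
| amalg: "a \<in> carrier A \<Longrightarrow> ([Inl (i a)], [Inr (j a)]) \<in> amalg_rel A G H i j"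

definition amalg_class ::
    "('a, 'l) monoid_scheme \<Rightarrow> ('g, 'm) monoid_scheme \<Rightarrow> ('h, 'n) monoid_scheme \<Rightarrow>
     ('a \<Rightarrow> 'g) \<Rightarrow> ('a \<Rightarrow> 'h) \<Rightarrow> ('g + 'h) list \<Rightarrow> ('g + 'h) list set" where
  "amalg_class A G H i j w = amalg_rel A G H i j `` {w}"

definition amalg_product ::
    "('a, 'l) monoid_scheme \<Rightarrow> ('g, 'm) monoid_scheme \<Rightarrow> ('h, 'n) monoid_scheme \<Rightarrow>
     ('a \<Rightarrow> 'g) \<Rightarrow> ('a \<Rightarrow> 'h) \<Rightarrow> ('g + 'h) list set monoid" where
  "amalg_product A G H i j =
     \<lparr>carrier = amalg_words G H // amalg_rel A G H i j,
      mult = (\<lambda>U V. \<Union>u\<in>U. \<Union>v\<in>V. amalg_class A G H i j (u @ v)),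
      one = amalg_class A G H i j []\<rparr>"

definition amalg_inl ::
    "('a, 'l) monoid_scheme \<Rightarrow> ('g, 'm) monoid_scheme \<Rightarrow> ('h, 'n) monoid_scheme \<Rightarrow>
     ('a \<Rightarrow> 'g) \<Rightarrow> ('a \<Rightarrow> 'h) \<Rightarrow> 'g \<Rightarrow> ('g + 'h) list set" where
  "amalg_inl A G H i j g = amalg_class A G H i j [Inl g]"

definition amalg_inr ::
    "('a, 'l) monoid_scheme \<Rightarrow> ('g, 'm) monoid_scheme \<Rightarrow> ('h, 'n) monoid_scheme \<Rightarrow>
     ('a \<Rightarrow> 'g) \<Rightarrow> ('a \<Rightarrow> 'h) \<Rightarrow> 'h \<Rightarrow> ('g + 'h) list set" where
  "amalg_inr A G H i j h = amalg_class A G H i j [Inr h]"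


subsection \<open>Group structure and universal property\<close>

context
  fixes A :: "('a, 'l) monoid_scheme" and G :: "('g, 'm) monoid_scheme"
    and H :: "('h, 'n) monoid_scheme" and i :: "'a \<Rightarrow> 'g" and j :: "'a \<Rightarrow> 'h"
  assumes G: "group G" and H: "group H"
    and i: "i \<in> hom A G" and j: "j \<in> hom A H"
begin

lemma amalg_rel_words:
  "(v, w) \<in> amalg_rel A G H i j \<Longrightarrow> v \<in> amalg_words G H \<and> w \<in> amalg_words G H"
proof (induction rule: amalg_rel.induct)
  case (amalg a)
  then show ?case using i j by (auto simp: hom_def)
next
  case one_left
  show ?case using group.is_monoid[OF G] by (simp add: InlI monoid.one_closed)
next
  case one_right
  show ?case using group.is_monoid[OF H] by (simp add: InrI monoid.one_closed)
next
  case (mult_left g g')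
  then show ?case using group.is_monoid[OF G] by (simp add: InlI monoid.m_closed)
next
  case (mult_right h h')
  then show ?case using group.is_monoid[OF H] by (simp add: InrI monoid.m_closed)
qed simp_all

lemma equiv_amalg_rel: "equiv (amalg_words G H) (amalg_rel A G H i j)"
proof (rule equivI)
  show "amalg_rel A G H i j \<subseteq> amalg_words G H \<times> amalg_words G H"
    using amalg_rel_words by auto
  show "refl_on (amalg_words G H) (amalg_rel A G H i j)"
    by (auto simp: refl_on_def intro: amalg_rel.refl)
  show "sym (amalg_rel A G H i j)"
    by (auto intro: symI amalg_rel.sym)
  show "trans (amalg_rel A G H i j)"
    by (auto intro: transI amalg_rel.trans)
qed

lemma amalg_class_eq_iff:
  assumes "v \<in> amalg_words G H" "w \<in> amalg_words G H"
  shows "amalg_class A G H i j v = amalg_class A G H i j w \<longleftrightarrow> (v, w) \<in> amalg_rel A G H i j"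
  using eq_equiv_class_iff[OF equiv_amalg_rel assms] by (simp add: amalg_class_def)

lemma amalg_class_closed:
  "w \<in> amalg_words G H \<Longrightarrow> amalg_class A G H i j w \<in> carrier (amalg_product A G H i j)"
  by (simp add: amalg_product_def amalg_class_def quotientI)

lemma amalg_product_cases:
  assumes "x \<in> carrier (amalg_product A G H i j)"
  obtains w where "w \<in> amalg_words G H" "x = amalg_class A G H i j w"
  using assms by (auto simp: amalg_product_def amalg_class_def elim!: quotientE)

lemma amalg_product_mult:
  assumes "v \<in> amalg_words G H" "w \<in> amalg_words G H"
  shows "amalg_class A G H i j v \<otimes>\<^bsub>amalg_product A G H i j\<^esub> amalg_class A G H i j w =
         amalg_class A G H i j (v @ w)"
proof -
  have eq: "amalg_class A G H i j (v' @ w') = amalg_class A G H i j (v @ w)"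
    if "v' \<in> amalg_class A G H i j v" "w' \<in> amalg_class A G H i j w" for v' w'
  proof -
    have *: "(v, v') \<in> amalg_rel A G H i j" "(w, w') \<in> amalg_rel A G H i j"
      using that by (auto simp: amalg_class_def)
    from amalg_rel.append[OF this] have "(v' @ w', v @ w) \<in> amalg_rel A G H i j"
      by (rule amalg_rel.sym)
    then show ?thesis
      unfolding amalg_class_def by (rule equiv_class_eq[OF equiv_amalg_rel])
  qed
  have mem: "v \<in> amalg_class A G H i j v" "w \<in> amalg_class A G H i j w"
    using assms by (simp_all add: amalg_class_def amalg_rel.refl)
  have "(\<Union>v'\<in>amalg_class A G H i j v. \<Union>w'\<in>amalg_class A G H i j w.
      amalg_class A G H i j (v' @ w')) = amalg_class A G H i j (v @ w)"
    by (rule UN_constant_eq[OF mem(1)], rule ballI, rule UN_constant_eq[OF mem(2)], rule ballI)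
      (rule eq)
  then show ?thesis
    by (simp add: amalg_product_def)
qed

lemma amalg_product_one: "\<one>\<^bsub>amalg_product A G H i j\<^esub> = amalg_class A G H i j []"
  by (simp add: amalg_product_def)

lemma amalg_word_inverse:
  "w \<in> amalg_words G H \<Longrightarrow>
   \<exists>v\<in>amalg_words G H. (v @ w, []) \<in> amalg_rel A G H i j"
proof (induction w)
  case Nil
  show ?case by (rule bexI[of _ "[]"]) (auto intro: amalg_rel.refl)
next
  case (Cons x w)
  then obtain v where v: "v \<in> amalg_words G H" "(v @ w, []) \<in> amalg_rel A G H i j"
    by auto
  obtain y where y: "[y] \<in> amalg_words G H" "([y, x], []) \<in> amalg_rel A G H i j"
  proof (cases x)
    case (Inl g)
    then have g: "g \<in> carrier G" using Cons.prems by auto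
    then have "inv\<^bsub>G\<^esub> g \<in> carrier G" using G by simp
    with g have "([Inl (inv\<^bsub>G\<^esub> g), x], [Inl (inv\<^bsub>G\<^esub> g \<otimes>\<^bsub>G\<^esub> g)]) \<in> amalg_rel A G H i j"
      unfolding Inl by (intro amalg_rel.mult_left)
    also have "inv\<^bsub>G\<^esub> g \<otimes>\<^bsub>G\<^esub> g = \<one>\<^bsub>G\<^esub>" using G g by (simp add: group.l_inv)
    finally have "([Inl (inv\<^bsub>G\<^esub> g), x], []) \<in> amalg_rel A G H i j"
      by (rule amalg_rel.trans[OF _ amalg_rel.one_left])
    with \<open>inv\<^bsub>G\<^esub> g \<in> carrier G\<close> show ?thesis using that[of "Inl (inv\<^bsub>G\<^esub> g)"] by auto
  next
    case (Inr h)
    then have h: "h \<in> carrier H" using Cons.prems by auto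
    then have "inv\<^bsub>H\<^esub> h \<in> carrier H" using H by simp
    with h have "([Inr (inv\<^bsub>H\<^esub> h), x], [Inr (inv\<^bsub>H\<^esub> h \<otimes>\<^bsub>H\<^esub> h)]) \<in> amalg_rel A G H i j"
      unfolding Inr by (intro amalg_rel.mult_right)
    also have "inv\<^bsub>H\<^esub> h \<otimes>\<^bsub>H\<^esub> h = \<one>\<^bsub>H\<^esub>" using H h by (simp add: group.l_inv)
    finally have "([Inr (inv\<^bsub>H\<^esub> h), x], []) \<in> amalg_rel A G H i j"
      by (rule amalg_rel.trans[OF _ amalg_rel.one_right])
    with \<open>inv\<^bsub>H\<^esub> h \<in> carrier H\<close> show ?thesis using that[of "Inr (inv\<^bsub>H\<^esub> h)"] by auto
  qed
  have w: "w \<in> amalg_words G H" using Cons.prems by auto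
  have "(v @ ([y, x] @ w), v @ ([] @ w)) \<in> amalg_rel A G H i j"
    using v(1) w y(2) by (intro amalg_rel.append amalg_rel.refl)
  from amalg_rel.trans[OF this] v(2)
  have "((v @ [y]) @ (x # w), []) \<in> amalg_rel A G H i j" by simp
  then show ?case using v(1) y(1) by (intro bexI[of _ "v @ [y]"]) auto
qed

lemma group_amalg_product: "group (amalg_product A G H i j)"
proof (rule groupI)
  let ?X = "amalg_product A G H i j"
  fix x assume x: "x \<in> carrier ?X"
  then obtain u where u: "u \<in> amalg_words G H" "x = amalg_class A G H i j u"
    by (rule amalg_product_cases)
  show "\<one>\<^bsub>?X\<^esub> \<otimes>\<^bsub>?X\<^esub> x = x"
    using u by (simp add: amalg_product_one amalg_product_mult)
  obtain v where v: "v \<in> amalg_words G H" "(v @ u, []) \<in> amalg_rel A G H i j"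
    using amalg_word_inverse[OF u(1)] by blast
  then have "amalg_class A G H i j v \<otimes>\<^bsub>?X\<^esub> x = \<one>\<^bsub>?X\<^esub>"
    using u by (simp add: amalg_product_one amalg_product_mult amalg_class_eq_iff)
  then show "\<exists>y\<in>carrier ?X. y \<otimes>\<^bsub>?X\<^esub> x = \<one>\<^bsub>?X\<^esub>"
    by (rule bexI) (rule amalg_class_closed[OF v(1)])
  fix y assume "y \<in> carrier ?X"
  then obtain v where v: "v \<in> amalg_words G H" "y = amalg_class A G H i j v"
    by (rule amalg_product_cases)
  show "x \<otimes>\<^bsub>?X\<^esub> y \<in> carrier ?X"
    using u v by (simp add: amalg_product_mult amalg_class_closed)
  fix z assume "z \<in> carrier ?X"
  then obtain w where w: "w \<in> amalg_words G H" "z = amalg_class A G H i j w"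
    by (rule amalg_product_cases)
  show "x \<otimes>\<^bsub>?X\<^esub> y \<otimes>\<^bsub>?X\<^esub> z = x \<otimes>\<^bsub>?X\<^esub> (y \<otimes>\<^bsub>?X\<^esub> z)"
    using u v w by (simp add: amalg_product_mult)
next
  show "\<one>\<^bsub>amalg_product A G H i j\<^esub> \<in> carrier (amalg_product A G H i j)"
    by (simp add: amalg_product_one amalg_class_closed)
qed

lemma amalg_inl_hom: "amalg_inl A G H i j \<in> hom G (amalg_product A G H i j)"
proof (rule homI)
  fix x y assume xy: "x \<in> carrier G" "y \<in> carrier G"
  have "([Inl x, Inl y], [Inl (x \<otimes>\<^bsub>G\<^esub> y)]) \<in> amalg_rel A G H i j"
    by (rule amalg_rel.mult_left[OF xy])
  then have "amalg_class A G H i j [Inl x, Inl y] = amalg_class A G H i j [Inl (x \<otimes>\<^bsub>G\<^esub> y)]"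
    unfolding amalg_class_def by (rule equiv_class_eq[OF equiv_amalg_rel])
  with xy show "amalg_inl A G H i j (x \<otimes>\<^bsub>G\<^esub> y) =
      amalg_inl A G H i j x \<otimes>\<^bsub>amalg_product A G H i j\<^esub> amalg_inl A G H i j y"
    by (simp add: amalg_inl_def amalg_product_mult InlI InrI)
next
  fix x assume "x \<in> carrier G"
  then show "amalg_inl A G H i j x \<in> carrier (amalg_product A G H i j)"
    by (simp add: amalg_inl_def amalg_class_closed InlI)
qed

lemma amalg_inr_hom: "amalg_inr A G H i j \<in> hom H (amalg_product A G H i j)"
proof (rule homI)
  fix x y assume xy: "x \<in> carrier H" "y \<in> carrier H"
  have "([Inr x, Inr y], [Inr (x \<otimes>\<^bsub>H\<^esub> y)]) \<in> amalg_rel A G H i j"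
    by (rule amalg_rel.mult_right[OF xy])
  then have "amalg_class A G H i j [Inr x, Inr y] = amalg_class A G H i j [Inr (x \<otimes>\<^bsub>H\<^esub> y)]"
    unfolding amalg_class_def by (rule equiv_class_eq[OF equiv_amalg_rel])
  with xy show "amalg_inr A G H i j (x \<otimes>\<^bsub>H\<^esub> y) =
      amalg_inr A G H i j x \<otimes>\<^bsub>amalg_product A G H i j\<^esub> amalg_inr A G H i j y"
    by (simp add: amalg_inr_def amalg_product_mult InlI InrI)
next
  fix x assume "x \<in> carrier H"
  then show "amalg_inr A G H i j x \<in> carrier (amalg_product A G H i j)"
    by (simp add: amalg_inr_def amalg_class_closed InrI)
qed

lemma amalg_inl_eq_inr:
  assumes "a \<in> carrier A"
  shows "amalg_inl A G H i j (i a) = amalg_inr A G H i j (j a)"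
  unfolding amalg_inl_def amalg_inr_def amalg_class_def
  by (rule equiv_class_eq[OF equiv_amalg_rel amalg_rel.amalg[OF assms]])

lemma amalg_product_universal:
  assumes K: "group K" and f: "f \<in> hom G K" and k: "k \<in> hom H K"
    and fk: "\<And>a. a \<in> carrier A \<Longrightarrow> f (i a) = k (j a)"
  shows "\<exists>\<phi>\<in>hom (amalg_product A G H i j) K.
           (\<forall>g\<in>carrier G. \<phi> (amalg_inl A G H i j g) = f g) \<and>
           (\<forall>h\<in>carrier H. \<phi> (amalg_inr A G H i j h) = k h)"
proof -
  interpret K: group K by (rule K)
  define ev where "ev w = foldr (\<lambda>l x. case_sum f k l \<otimes>\<^bsub>K\<^esub> x) w \<one>\<^bsub>K\<^esub>" for w
  have f_cl: "f g \<in> carrier K" if "g \<in> carrier G" for g using f that by (auto simp: hom_def)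
  have k_cl: "k h \<in> carrier K" if "h \<in> carrier H" for h using k that by (auto simp: hom_def)
  have ev_simps: "ev [] = \<one>\<^bsub>K\<^esub>" "ev (l # w) = case_sum f k l \<otimes>\<^bsub>K\<^esub> ev w" for l w
    by (simp_all add: ev_def)
  have ev_closed: "ev w \<in> carrier K" if "w \<in> amalg_words G H" for w
    using that by (induction w) (auto simp: ev_simps f_cl k_cl)
  have ev_append: "ev (v @ w) = ev v \<otimes>\<^bsub>K\<^esub> ev w"
    if "v \<in> amalg_words G H" "w \<in> amalg_words G H" for v w
    using that(1)
  proof (induction v)
    case Nil
    show ?case using ev_closed[OF that(2)] by (simp add: ev_simps)
  next
    case (Cons l v)
    then have "case_sum f k l \<in> carrier K" "v \<in> amalg_words G H"
      by (auto simp: f_cl k_cl)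
    then show ?case
      using Cons.IH ev_closed[OF that(2)] ev_closed[of v] by (simp add: ev_simps K.m_assoc)
  qed
  have ev_rel: "ev v = ev w" if "(v, w) \<in> amalg_rel A G H i j" for v w
    using that
  proof (induction rule: amalg_rel.induct)
    case (append u u' v v')
    then show ?case using amalg_rel_words by (metis ev_append)
  next
    case one_left
    show ?case using hom_one[OF f G K] by (simp add: ev_simps)
  next
    case one_right
    show ?case using hom_one[OF k H K] by (simp add: ev_simps)
  next
    case (mult_left g g')
    then show ?case using f by (simp add: ev_simps f_cl hom_mult)
  next
    case (mult_right h h')
    then show ?case using k by (simp add: ev_simps k_cl hom_mult)
  next
    case (amalg a)
    then show ?case by (simp add: ev_simps fk)
  qed auto
  define \<phi> where "\<phi> x = ev (SOME w. w \<in> x)" for x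
  have \<phi>_class: "\<phi> (amalg_class A G H i j w) = ev w" if "w \<in> amalg_words G H" for w
  proof -
    have "w \<in> amalg_class A G H i j w"
      using that by (auto simp: amalg_class_def intro: amalg_rel.refl)
    then have "(SOME v. v \<in> amalg_class A G H i j w) \<in> amalg_class A G H i j w"
      by (rule someI)
    then show ?thesis unfolding \<phi>_def by (auto simp: amalg_class_def dest: ev_rel)
  qed
  have "\<phi> \<in> hom (amalg_product A G H i j) K"
  proof (rule homI)
    fix x assume "x \<in> carrier (amalg_product A G H i j)"
    then obtain v where v: "v \<in> amalg_words G H" "x = amalg_class A G H i j v"
      by (rule amalg_product_cases)
    then show "\<phi> x \<in> carrier K" by (simp only: \<phi>_class ev_closed)
    fix y assume "y \<in> carrier (amalg_product A G H i j)"
    then obtain w where w: "w \<in> amalg_words G H" "y = amalg_class A G H i j w"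
      by (rule amalg_product_cases)
    show "\<phi> (x \<otimes>\<^bsub>amalg_product A G H i j\<^esub> y) = \<phi> x \<otimes>\<^bsub>K\<^esub> \<phi> y"
      using v w by (simp only: \<phi>_class amalg_product_mult ev_append append_in_lists_conv)
  qed
  moreover have "\<forall>g\<in>carrier G. \<phi> (amalg_inl A G H i j g) = f g"
    using \<phi>_class[of "[Inl _]"] by (simp add: InlI amalg_inl_def ev_simps f_cl)
  moreover have "\<forall>h\<in>carrier H. \<phi> (amalg_inr A G H i j h) = k h"
    using \<phi>_class[of "[Inr _]"] by (simp add: InrI amalg_inr_def ev_simps k_cl)
  ultimately show ?thesis by blast
qed

lemma amalg_product_universal_unique:
  assumes K: "group K" and \<phi>: "\<phi> \<in> hom (amalg_product A G H i j) K"
    and \<psi>: "\<psi> \<in> hom (amalg_product A G H i j) K"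
    and inl: "\<And>g. g \<in> carrier G \<Longrightarrow> \<phi> (amalg_inl A G H i j g) = \<psi> (amalg_inl A G H i j g)"
    and inr: "\<And>h. h \<in> carrier H \<Longrightarrow> \<phi> (amalg_inr A G H i j h) = \<psi> (amalg_inr A G H i j h)"
    and x: "x \<in> carrier (amalg_product A G H i j)"
  shows "\<phi> x = \<psi> x"
proof -
  have "\<phi> (amalg_class A G H i j w) = \<psi> (amalg_class A G H i j w)"
    if "w \<in> amalg_words G H" for w
    using that
  proof (induction w)
    case Nil
    show ?case
      using hom_one[OF \<phi> group_amalg_product K] hom_one[OF \<psi> group_amalg_product K]
      by (simp add: amalg_product_one)
  next
    case (Cons l w)
    then have lw: "[l] \<in> amalg_words G H" "w \<in> amalg_words G H" by auto
    have l: "\<phi> (amalg_class A G H i j [l]) = \<psi> (amalg_class A G H i j [l])"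
      using lw(1) inl inr by (auto simp: amalg_inl_def amalg_inr_def)
    have "amalg_class A G H i j (l # w) = amalg_class A G H i j [l]
        \<otimes>\<^bsub>amalg_product A G H i j\<^esub> amalg_class A G H i j w"
      using amalg_product_mult[OF lw] by simp
    then show ?case
      using l Cons.IH lw \<phi> \<psi> by (simp add: hom_mult amalg_class_closed)
  qed
  with x show ?thesis by (metis amalg_product_cases)
qed

end

end

theory Submission
  imports Defs "HOL-Algebra.Bij"
begin

text \<open>
  Write \<open>u\<close>, \<open>p\<close>, \<open>q\<close> for the minimal positive elements of \<open>A\<close>, \<open>G\<close>, \<open>H\<close> and \<open>z = q u\<inverse> p\<close>. Every
  element of \<open>X\<close> is \<open>a w\<close> with \<open>a\<close> in \<open>A\<close> and \<open>w\<close> an alternating word in letters \<open>s\<close> of \<open>G\<close> with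
  \<open>u\<inverse> < s < 1\<close> and letters \<open>t\<close> of \<open>H\<close> with \<open>1 < t < u\<close>. If a left-invariant strict partial order
  extends the orders of \<open>G\<close> and \<open>H\<close> and makes \<open>z\<close> positive, induction on the length puts the words
  starting in \<open>H\<close> between \<open>1\<close> and \<open>p\<close> and those starting in \<open>G\<close> between \<open>q\<inverse>\<close> and \<open>1\<close>. So such an
  order is total, has \<open>z\<close> as its minimal positive element and \<open>A\<close> as a stepping. It is unique,
  because the intersection of two such orders is again one, hence total.

  It exists because \<open>X\<close> acts on the lexicographically ordered set of pairs \<open>(a, w)\<close>: cutting off a
  leading letter from \<open>G\<close> identifies this set with a lexicographic product whose first factor is \<open>G\<close>,
  and likewise for \<open>H\<close>, so that both groups act by order automorphisms, and they agree on \<open>A\<close>.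

  Exchanging \<open>G\<close> and \<open>H\<close> yields the second order.
\<close>

section \<open>Left-invariant partial orders\<close>

text \<open>Totality is left out on purpose: the order constructed on \<open>X\<close> is at first
  only known to be partial, and the uniqueness argument passes to the intersection of two
  orders.\<close>

locale partial_left_order = group X for X (structure) +
  fixes R :: "'a rel"
  assumes R_subset: "R \<subseteq> carrier X \<times> carrier X"
    and R_trans: "trans R" and R_irrefl: "irrefl R"
    and R_mult: "(a, b) \<in> R \<Longrightarrow> g \<in> carrier X \<Longrightarrow> (g \<otimes> a, g \<otimes> b) \<in> R"
begin

abbreviation lt (infix "\<prec>" 50) where "x \<prec> y \<equiv> (x, y) \<in> R"
abbreviation le (infix "\<preceq>" 50) where "x \<preceq> y \<equiv> (x, y) \<in> R\<^sup>="

lemma lt_closed: "x \<prec> y \<Longrightarrow> x \<in> carrier X" "x \<prec> y \<Longrightarrow> y \<in> carrier X"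
  using R_subset by auto

lemma lt_trans [trans]: "x \<prec> y \<Longrightarrow> y \<prec> z \<Longrightarrow> x \<prec> z"
  using R_trans by (rule transD)

lemma lt_le_trans [trans]: "x \<prec> y \<Longrightarrow> y \<preceq> z \<Longrightarrow> x \<prec> z"
  and le_lt_trans [trans]: "x \<preceq> y \<Longrightarrow> y \<prec> z \<Longrightarrow> x \<prec> z"
  and le_trans [trans]: "x \<preceq> y \<Longrightarrow> y \<preceq> z \<Longrightarrow> x \<preceq> z"
  by (auto intro: lt_trans)

lemma lt_irrefl: "\<not> x \<prec> x"
  using R_irrefl by (rule irreflD)

lemma le_not_lt: "x \<preceq> y \<Longrightarrow> \<not> y \<prec> x"
  using lt_irrefl lt_trans by blast

lemma le_mult: "x \<preceq> y \<Longrightarrow> g \<in> carrier X \<Longrightarrow> g \<otimes> x \<preceq> g \<otimes> y"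
  using R_mult by auto

lemma lt_mult_iff:
  assumes "g \<in> carrier X" "x \<in> carrier X" "y \<in> carrier X"
  shows "g \<otimes> x \<prec> g \<otimes> y \<longleftrightarrow> x \<prec> y"
proof
  assume "g \<otimes> x \<prec> g \<otimes> y"
  from R_mult[OF this, of "inv g"] assms show "x \<prec> y" by (simp flip: m_assoc)
qed (use R_mult assms in blast)

lemma lt_iff_pos:
  assumes "x \<in> carrier X" "y \<in> carrier X"
  shows "x \<prec> y \<longleftrightarrow> \<one> \<prec> inv x \<otimes> y"
  using lt_mult_iff[of "inv x" x y] assms by simp

lemma lt_mult_right:
  assumes "x \<in> carrier X" "y \<in> carrier X"
  shows "x \<prec> x \<otimes> y \<longleftrightarrow> \<one> \<prec> y" "x \<otimes> y \<prec> x \<longleftrightarrow> y \<prec> \<one>"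
  using lt_mult_iff[of x \<one> y] lt_mult_iff[of x y \<one>] assms by simp_all

lemma inv_pos_iff:
  assumes "x \<in> carrier X"
  shows "inv x \<prec> \<one> \<longleftrightarrow> \<one> \<prec> x" "\<one> \<prec> inv x \<longleftrightarrow> x \<prec> \<one>"
  using lt_mult_iff[of x "inv x" \<one>] lt_mult_iff[of x \<one> "inv x"] assms by auto

end

lemma LO_partial_left_order:
  assumes "group G" "r \<in> LO G"
  shows "partial_left_order G r"
  using assms
  by (auto simp: LO_def strict_linear_order_on_def partial_left_order_def
      partial_left_order_axioms_def)

section \<open>Discrete totally ordered subgroups\<close>

locale discrete_subgroup = partial_left_order +
  fixes S :: "'a set" and m :: 'a
  assumes S_subgroup: "subgroup S X" and S_total: "total_on S R"
    and m_mem: "m \<in> S" and m_pos: "\<one> \<prec> m"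
    and m_least: "x \<in> S \<Longrightarrow> \<one> \<prec> x \<Longrightarrow> m \<preceq> x"
begin

lemma mem_carrier: "x \<in> S \<Longrightarrow> x \<in> carrier X"
  using subgroup.subset[OF S_subgroup] by blast

lemma mult_mem: "x \<in> S \<Longrightarrow> y \<in> S \<Longrightarrow> x \<otimes> y \<in> S"
  using subgroup.m_closed[OF S_subgroup] .

lemma inv_mem: "x \<in> S \<Longrightarrow> inv x \<in> S"
  using subgroup.m_inv_closed[OF S_subgroup] .

lemma one_mem: "\<one> \<in> S"
  using subgroup.one_closed[OF S_subgroup] .

lemma not_lt: "x \<in> S \<Longrightarrow> y \<in> S \<Longrightarrow> \<not> x \<prec> y \<Longrightarrow> y \<preceq> x"
  using S_total by (auto simp: total_on_def)

text \<open>Left translation by \<open>inv x\<close> reduces this to \<open>m_least\<close>. Right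
  multiplication by \<open>m\<close> is thus the successor map of \<open>S\<close>.\<close>

lemma succ_le:
  assumes "x \<in> S" "y \<in> S" "x \<prec> y"
  shows "x \<otimes> m \<preceq> y"
proof -
  have "m \<preceq> inv x \<otimes> y"
    using assms by (intro m_least) (auto simp: mult_mem inv_mem mem_carrier simp flip: lt_iff_pos)
  from le_mult[OF this, of x] assms show ?thesis
    by (simp add: mem_carrier flip: m_assoc)
qed

lemma le_pred:
  assumes "x \<in> S" "y \<in> S" "x \<prec> y"
  shows "x \<preceq> y \<otimes> inv m"
proof (rule not_lt)
  show "\<not> y \<otimes> inv m \<prec> x"
  proof
    assume "y \<otimes> inv m \<prec> x"
    with succ_le[of "y \<otimes> inv m" x] assms have "y \<preceq> x"
      by (simp add: mult_mem inv_mem m_mem mem_carrier m_assoc)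
    with le_not_lt assms show False by blast
  qed
qed (use assms in \<open>auto simp: mult_mem inv_mem m_mem\<close>)

end

section \<open>Orders in which \<open>q u\<inverse> p\<close> is positive\<close>

text \<open>Here \<open>A\<close>, \<open>G\<close>, \<open>H\<close> are subgroups of
  \<open>X\<close>. Representatives modulo \<open>A\<close> are taken at most 1 in \<open>G\<close>
  and at least 1 in \<open>H\<close>, which matches the choice of \<open>q u\<inverse> p\<close>
  over \<open>p u\<inverse> q\<close>. Of the amalgamated product itself only the generation by
  \<open>G\<close> and \<open>H\<close> enters.\<close>

locale amalgam_order = partial_left_order +
  A: discrete_subgroup X R A u + G: discrete_subgroup X R G p + H: discrete_subgroup X R H q
  for A u G p H q +
  assumes A_G: "A \<subseteq> G" and A_H: "A \<subseteq> H"
    and G_decomp: "g \<in> G \<Longrightarrow> \<exists>a\<in>A. \<exists>s\<in>G. g = a \<otimes> s \<and> inv u \<prec> s \<and> s \<preceq> \<one>"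
    and H_decomp: "h \<in> H \<Longrightarrow> \<exists>a\<in>A. \<exists>t\<in>H. h = a \<otimes> t \<and> \<one> \<preceq> t \<and> t \<prec> u"
    and generated: "\<one> \<in> Y \<Longrightarrow>
      (\<And>g y. g \<in> G \<Longrightarrow> y \<in> carrier X \<Longrightarrow> y \<in> Y \<Longrightarrow> g \<otimes> y \<in> Y) \<Longrightarrow>
      (\<And>h y. h \<in> H \<Longrightarrow> y \<in> carrier X \<Longrightarrow> y \<in> Y \<Longrightarrow> h \<otimes> y \<in> Y) \<Longrightarrow> carrier X \<subseteq> Y"
    and z_pos: "\<one> \<prec> q \<otimes> inv u \<otimes> p"
begin

text \<open>The values in \<open>X\<close> of the alternating words that do not start in
  \<open>G\<close> (for \<open>B\<close>) or in \<open>H\<close> (for \<open>C\<close>). Sets of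
  elements suffice, since the bounds below do not depend on how an element is written as a
  word.\<close>

inductive_set B and C where
  B_one: "\<one> \<in> B"
| C_one: "\<one> \<in> C"
| B_step: "t \<in> H \<Longrightarrow> \<one> \<prec> t \<Longrightarrow> t \<prec> u \<Longrightarrow> c \<in> C \<Longrightarrow> t \<otimes> c \<in> B"
| C_step: "s \<in> G \<Longrightarrow> inv u \<prec> s \<Longrightarrow> s \<prec> \<one> \<Longrightarrow> b \<in> B \<Longrightarrow> s \<otimes> b \<in> C"

lemma u_G: "u \<in> G" and u_H: "u \<in> H"
  using A.m_mem A_G A_H by auto

lemmas carrier_simps = A.mem_carrier G.mem_carrier H.mem_carrier A.m_mem G.m_mem H.m_mem

lemma closed [simp]: "u \<in> carrier X" "p \<in> carrier X" "q \<in> carrier X"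
  by (simp_all add: carrier_simps)

text \<open>Left translation of \<open>z_pos\<close> by \<open>inv q\<close>, and then by
  \<open>u\<close>. In this form it links the letters of one factor to the minimal positive element
  of the other.\<close>

lemma z_pos': "inv q \<prec> inv u \<otimes> p" "u \<otimes> inv q \<prec> p"
proof -
  show "inv q \<prec> inv u \<otimes> p"
    using z_pos by (subst lt_iff_pos) (simp_all add: m_assoc)
  from R_mult[OF this, of u] show "u \<otimes> inv q \<prec> p"
    by (simp flip: m_assoc)
qed

lemma p_le_u: "p \<preceq> u"
  using G.m_least[OF u_G A.m_pos] .

lemma inv_u_le: "inv u \<preceq> inv q"
  using H.le_pred[of "inv u" \<one>] A.m_pos by (simp add: H.inv_mem u_H H.one_mem inv_pos_iff)

lemma B_C_closed: "b \<in> B \<Longrightarrow> b \<in> carrier X" "c \<in> C \<Longrightarrow> c \<in> carrier X"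
  by (induction rule: B_C.inducts) (auto simp: carrier_simps)

text \<open>Simultaneous induction. By discreteness of \<open>H\<close>,
  \<open>\<one> \<preceq> t q\<inverse>\<close>, and a tail \<open>c\<close> above
  \<open>q\<inverse>\<close> lowers \<open>t\<close> by less than one step, so \<open>t c\<close>
  does not become negative; from above,
  \<open>t c \<preceq> t \<preceq> u q\<inverse> \<prec> p\<close>. For a letter of
  \<open>G\<close>, \<open>s p \<preceq> \<one>\<close> and
  \<open>q\<inverse> \<prec> u\<inverse> p \<preceq> s\<close> play these roles.\<close>

lemma B_C_bounds:
  "b \<in> B \<Longrightarrow> \<one> \<preceq> b \<and> b \<prec> p"
  "c \<in> C \<Longrightarrow> inv q \<prec> c \<and> c \<preceq> \<one>"
proof (induction rule: B_C.inducts)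
  case B_one
  show ?case using G.m_pos by simp
next
  case C_one
  show ?case using H.m_pos by (simp add: inv_pos_iff)
next
  case (B_step t c)
  then have [simp]: "t \<in> carrier X" "c \<in> carrier X" by (auto simp: carrier_simps B_C_closed)
  have "\<one> \<preceq> t \<otimes> inv q"
    using B_step by (intro H.le_pred) (auto simp: H.one_mem)
  also have "t \<otimes> inv q \<preceq> t \<otimes> c" using B_step by (intro le_mult) auto
  finally have 1: "\<one> \<preceq> t \<otimes> c" .
  have "t \<otimes> c \<preceq> t" using B_step le_mult[of c \<one> t] by simp
  also have "t \<preceq> u \<otimes> inv q" using B_step by (intro H.le_pred) (auto simp: u_H)
  also have "u \<otimes> inv q \<prec> p" by (rule z_pos')
  finally show ?case using 1 by blast
next
  case (C_step s b)
  then have [simp]: "s \<in> carrier X" "b \<in> carrier X" by (auto simp: carrier_simps B_C_closed)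
  have "s \<otimes> b \<preceq> s \<otimes> p" using C_step by (intro le_mult) auto
  also have "s \<otimes> p \<preceq> \<one>" using C_step by (intro G.succ_le) (auto simp: G.one_mem)
  finally have 1: "s \<otimes> b \<preceq> \<one>" .
  have "inv q \<prec> inv u \<otimes> p" by (rule z_pos')
  also have "inv u \<otimes> p \<preceq> s"
    using C_step by (intro G.succ_le) (auto simp: u_G G.inv_mem)
  also have "s \<preceq> s \<otimes> b" using C_step le_mult[of \<one> b s] by simp
  finally show ?case using 1 by blast
qed

text \<open>The products \<open>a w\<close> contain 1 and are closed under left multiplication by
  both factors. A leading letter from the same factor is first merged with the multiplier; the
  result is then split again by \<open>G_decomp\<close> or \<open>H_decomp\<close>.\<close>

lemma A_B_C_decomp: "x \<in> carrier X \<Longrightarrow> \<exists>a\<in>A. \<exists>w\<in>B \<union> C. x = a \<otimes> w"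
proof -
  let ?Y = "{x. \<exists>a\<in>A. \<exists>w\<in>B \<union> C. x = a \<otimes> w}"
  have "carrier X \<subseteq> ?Y"
  proof (rule generated)
    show "\<one> \<in> ?Y"
      using A.one_mem B_one by (intro CollectI bexI[of _ \<one>]) auto
  next
    fix g x assume g: "g \<in> G" and "x \<in> ?Y"
    then obtain a w where aw: "a \<in> A" "w \<in> B \<union> C" "x = a \<otimes> w" by blast
    obtain g' b where g': "g' \<in> G" and b: "b \<in> B" and eq: "g \<otimes> x = g' \<otimes> b"
    proof (cases "w \<in> B")
      case True
      with aw g show ?thesis using A_G
        by (intro that[of "g \<otimes> a" w]) (auto simp: G.mult_mem m_assoc carrier_simps B_C_closed)
    next
      case False
      \<comment> \<open>Since 1 lies in \<open>B\<close>, an element of \<open>C\<close> outside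
        \<open>B\<close> must come from \<open>C_step\<close>.\<close>
      with aw have "w \<in> C" "w \<noteq> \<one>" by (auto intro: B_one)
      then obtain s b where sb: "w = s \<otimes> b" "s \<in> G" "b \<in> B" by (cases) auto
      with aw g show ?thesis using A_G
        by (intro that[of "g \<otimes> a \<otimes> s" b])
          (auto simp: G.mult_mem m_assoc carrier_simps B_C_closed)
    qed
    obtain a s where as: "a \<in> A" "s \<in> G" "g' = a \<otimes> s" "inv u \<prec> s" "s \<preceq> \<one>"
      using G_decomp[OF g'] by blast
    \<comment> \<open>A trivial letter is not written; the word is then \<open>b\<close>
      itself.\<close>
    have "s \<otimes> b \<in> B \<union> C"
      using as b by (cases "s = \<one>") (auto simp: B_C_closed intro: C_step)
    moreover have "g \<otimes> x = a \<otimes> (s \<otimes> b)"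
      using as b by (simp add: eq m_assoc carrier_simps B_C_closed)
    ultimately show "g \<otimes> x \<in> ?Y"
      using as by blast
  next
    fix h x assume h: "h \<in> H" and "x \<in> ?Y"
    then obtain a w where aw: "a \<in> A" "w \<in> B \<union> C" "x = a \<otimes> w" by blast
    obtain h' c where h': "h' \<in> H" and c: "c \<in> C" and eq: "h \<otimes> x = h' \<otimes> c"
    proof (cases "w \<in> C")
      case True
      with aw h show ?thesis using A_H
        by (intro that[of "h \<otimes> a" w]) (auto simp: H.mult_mem m_assoc carrier_simps B_C_closed)
    next
      case False
      with aw have "w \<in> B" "w \<noteq> \<one>" by (auto intro: C_one)
      then obtain t c where tc: "w = t \<otimes> c" "t \<in> H" "c \<in> C" by (cases) auto
      with aw h show ?thesis using A_H
        by (intro that[of "h \<otimes> a \<otimes> t" c])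
          (auto simp: H.mult_mem m_assoc carrier_simps B_C_closed)
    qed
    obtain a t where at: "a \<in> A" "t \<in> H" "h' = a \<otimes> t" "\<one> \<preceq> t" "t \<prec> u"
      using H_decomp[OF h'] by blast
    have "t \<otimes> c \<in> B \<union> C"
      using at c by (cases "t = \<one>") (auto simp: B_C_closed intro: B_step)
    moreover have "h \<otimes> x = a \<otimes> (t \<otimes> c)"
      using at c by (simp add: eq m_assoc carrier_simps B_C_closed)
    ultimately show "h \<otimes> x \<in> ?Y"
      using at by blast
  qed
  then show "x \<in> carrier X \<Longrightarrow> \<exists>a\<in>A. \<exists>w\<in>B \<union> C. x = a \<otimes> w" by blast
qed

section \<open>Floors in \<open>A\<close>, totality and the minimal positive element\<close>

lemma A_floor:
  assumes "x \<in> carrier X"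
  shows "\<exists>a\<in>A. a \<preceq> x \<and> x \<prec> a \<otimes> u"
proof -
  obtain a w where a: "a \<in> A" and w: "w \<in> B \<union> C" and x: "x = a \<otimes> w"
    using A_B_C_decomp[OF assms] by blast
  have [simp]: "a \<in> carrier X" "w \<in> carrier X" using a w by (auto simp: carrier_simps B_C_closed)
  show ?thesis
  proof (cases "\<one> \<preceq> w")
    case True
    \<comment> \<open>A word in \<open>B\<close> is below \<open>p \<preceq> u\<close>, and one in
      \<open>C\<close> is at most 1.\<close>
    have "w \<prec> u"
      using w B_C_bounds(1)[of w] B_C_bounds(2)[of w] True p_le_u A.m_pos
        lt_le_trans le_not_lt by blast
    then show ?thesis
      using a True le_mult[of \<one> w a] R_mult[of w u a] by (auto simp: x)
  next
    case False
    then have "inv q \<prec> w" "w \<prec> \<one>" using w B_C_bounds(1)[of w] B_C_bounds(2)[of w] by auto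
    then have "inv u \<preceq> w" using inv_u_le le_lt_trans by blast
    then have "a \<otimes> inv u \<preceq> x \<and> x \<prec> a"
      using le_mult[of "inv u" w a] R_mult[of w \<one> a] \<open>w \<prec> \<one>\<close> by (simp add: x)
    \<comment> \<open>A negative word is at least \<open>inv u\<close>, so the floor drops from
      \<open>a\<close> to \<open>a \<otimes> inv u\<close>.\<close>
    then show ?thesis
      using a by (intro bexI[of _ "a \<otimes> inv u"])
        (auto simp: m_assoc A.mult_mem A.inv_mem A.m_mem)
  qed
qed

text \<open>It suffices to find the sign of one element, and its floor decides it: a floor
  \<open>a' \<prec> \<one>\<close> in \<open>A\<close> forces
  \<open>a' \<otimes> u \<preceq> \<one>\<close> by discreteness.\<close>

lemma total: "total_on (carrier X) R"
proof -
  have pos_or_neg: "\<one> \<preceq> x \<or> x \<prec> \<one>" if x: "x \<in> carrier X" for x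
  proof -
    obtain a' where a': "a' \<in> A" "a' \<preceq> x" "x \<prec> a' \<otimes> u"
      using A_floor[OF x] by blast
    consider "a' \<prec> \<one>" | "\<one> \<preceq> a'" using A.not_lt[OF a'(1) A.one_mem] by blast
    then show ?thesis
    proof cases
      case 1
      then have "a' \<otimes> u \<preceq> \<one>" using A.succ_le[OF a'(1) A.one_mem] by blast
      then show ?thesis using a' lt_le_trans by blast
    next
      case 2
      then show ?thesis using a' le_trans by blast
    qed
  qed
  show ?thesis
  proof (rule total_onI)
    fix x y assume xy: "x \<in> carrier X" "y \<in> carrier X" "x \<noteq> y"
    have "\<one> \<noteq> inv x \<otimes> y" using xy by (metis inv_equality inv_inv inv_closed)
    with pos_or_neg[of "inv x \<otimes> y"] xy have "\<one> \<prec> inv x \<otimes> y \<or> inv x \<otimes> y \<prec> \<one>" by auto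
    then show "x \<prec> y \<or> y \<prec> x"
      using xy lt_mult_iff[of x \<one> "inv x \<otimes> y"] lt_mult_iff[of x "inv x \<otimes> y" \<one>]
      by (auto simp flip: m_assoc)
  qed
qed

text \<open>After translation by \<open>inv q\<close>, no \<open>y\<close> may lie strictly between
  \<open>q\<inverse>\<close> and \<open>u\<inverse> p\<close>. Write \<open>y = a w\<close>. If
  \<open>w\<close> is in \<open>C\<close>, the bounds force \<open>a = \<one>\<close>, so
  \<open>y\<close> starts with a letter \<open>s \<succeq> u\<inverse> p\<close>, too large. If
  \<open>w\<close> starts with a letter \<open>t\<close> of \<open>H\<close>, discreteness of
  \<open>H\<close> gives \<open>\<one> \<preceq> a t \<prec> a u\<close>, while
  \<open>a \<prec> \<one>\<close> gives \<open>a u \<preceq> \<one>\<close>.\<close>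

lemma min_positive:
  assumes "\<one> \<prec> x"
  shows "q \<otimes> inv u \<otimes> p \<preceq> x"
proof -
  have [simp]: "x \<in> carrier X" using lt_closed assms by blast
  have no_between: False if y: "inv q \<prec> y" "y \<prec> inv u \<otimes> p" for y
  proof -
    have "inv u \<otimes> p \<preceq> \<one>"
      using p_le_u le_mult[of p u "inv u"] by simp
    then have y1: "y \<prec> \<one>" using y lt_le_trans by blast
    obtain a w where a: "a \<in> A" and w: "w \<in> B \<union> C" and yaw: "y = a \<otimes> w"
      using A_B_C_decomp lt_closed(1)[OF y1] by blast
    have [simp]: "a \<in> carrier X" "w \<in> carrier X" using a w by (auto simp: carrier_simps B_C_closed)
    show False
    proof (cases "w \<in> C")
      case True
      have "a \<otimes> inv u \<preceq> a \<otimes> inv q" using inv_u_le by (rule le_mult) simp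
      also have "a \<otimes> inv q \<preceq> y"
        using B_C_bounds(2)[OF True] le_mult[of "inv q" w a] by (simp add: yaw)
      finally have "a \<otimes> inv u \<prec> \<one>" using y1 le_lt_trans by blast
      then have "a \<preceq> \<one>"
        using A.succ_le[of "a \<otimes> inv u" \<one>] a
        by (simp add: A.mult_mem A.inv_mem A.m_mem A.one_mem m_assoc)
      moreover have "y \<preceq> a"
        using B_C_bounds(2)[OF True] le_mult[of w \<one> a] by (simp add: yaw)
      then have "inv u \<prec> a" using y(1) inv_u_le le_lt_trans lt_le_trans by blast
      then have "\<one> \<preceq> a"
        using A.succ_le[of "inv u" a] a by (simp add: A.inv_mem A.m_mem)
      ultimately have "a = \<one>" using le_not_lt by blast
      then have "y \<in> C" using True by (simp add: yaw)
      then show False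
      proof cases
        case C_one
        then show False using y1 lt_irrefl by blast
      next
        case (C_step s b)
        have "inv u \<otimes> p \<preceq> s" using C_step by (intro G.succ_le) (auto simp: u_G G.inv_mem)
        also have "s \<preceq> y"
          using C_step B_C_bounds(1)[of b] le_mult[of \<one> b s] by (simp add: G.mem_carrier)
        finally show False using y(2) le_not_lt by blast
      qed
    next
      case False
      with w have "w \<in> B" "w \<noteq> \<one>" by (auto intro: C_one)
      then obtain t c where tc: "w = t \<otimes> c" "t \<in> H" "\<one> \<prec> t" "t \<prec> u" "c \<in> C" by cases auto
      have [simp]: "t \<in> carrier X" "c \<in> carrier X" using tc by (auto simp: carrier_simps B_C_closed)
      have at: "a \<otimes> t \<in> H" using a tc A_H by (auto simp: H.mult_mem)
      have "y \<preceq> a \<otimes> t"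
        using le_mult[of c \<one> "a \<otimes> t"] B_C_bounds(2)[OF tc(5)] by (simp add: yaw tc m_assoc)
      then have "inv q \<prec> a \<otimes> t" using y(1) lt_le_trans by blast
      then have "\<one> \<preceq> a \<otimes> t"
        using H.succ_le[of "inv q" "a \<otimes> t"] at by (simp add: H.inv_mem H.m_mem)
      moreover have "a \<preceq> y"
        using B_C_bounds(1)[OF \<open>w \<in> B\<close>] le_mult[of \<one> w a] by (simp add: yaw)
      then have "a \<prec> \<one>" using y1 le_lt_trans by blast
      then have "a \<otimes> u \<preceq> \<one>" using A.succ_le[OF a A.one_mem] by blast
      moreover have "a \<otimes> t \<prec> a \<otimes> u" using R_mult[OF tc(4), of a] by simp
      ultimately show False using le_not_lt lt_le_trans by blast
    qed
  qed
  show ?thesis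
  proof (rule ccontr)
    assume "\<not> q \<otimes> inv u \<otimes> p \<preceq> x"
    then have "x \<prec> q \<otimes> inv u \<otimes> p"
      using total[unfolded total_on_def, rule_format, of x "q \<otimes> inv u \<otimes> p"] by auto
    from R_mult[OF this, of "inv q"] have "inv q \<otimes> x \<prec> inv u \<otimes> p"
      by (simp add: m_assoc flip: m_assoc[of "inv q" q])
    moreover have "inv q \<prec> inv q \<otimes> x" using assms by (simp add: lt_mult_right)
    ultimately show False using no_between by blast
  qed
qed

end

section \<open>Actions on ordered words\<close>

locale stepped_extension =
  A: partial_left_order A rA + G: partial_left_order G rG
  for A :: "('a, 'l) monoid_scheme" and rA and G :: "('g, 'm) monoid_scheme" and rG +
  fixes i :: "'a \<Rightarrow> 'g" and u :: 'a
  assumes A_total: "total_on (carrier A) rA" and G_total: "total_on (carrier G) rG"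
    and i_hom: "i \<in> hom A G"
    and i_mono: "(a, a') \<in> rA \<Longrightarrow> (i a, i a') \<in> rG"
    and u_min: "is_min_positive A rA u"
    and floor: "g \<in> carrier G \<Longrightarrow>
      \<exists>a\<in>carrier A. (i a, g) \<in> rG\<^sup>= \<and> (g, i (a \<otimes>\<^bsub>A\<^esub> u)) \<in> rG"
begin

lemma u_pos: "(\<one>\<^bsub>A\<^esub>, u) \<in> rA" and u_least: "(\<one>\<^bsub>A\<^esub>, a) \<in> rA \<Longrightarrow> (u, a) \<in> rA\<^sup>="
  using u_min by (auto simp: is_min_positive_def)

lemma u_closed [simp]: "u \<in> carrier A"
  using u_pos A.lt_closed by blast

lemma i_closed [simp]: "a \<in> carrier A \<Longrightarrow> i a \<in> carrier G"
  using i_hom by (auto simp: hom_def)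

lemma i_mult [simp]: "a \<in> carrier A \<Longrightarrow> b \<in> carrier A \<Longrightarrow> i (a \<otimes>\<^bsub>A\<^esub> b) = i a \<otimes>\<^bsub>G\<^esub> i b"
  using i_hom by (auto simp: hom_def)

lemma i_one [simp]: "i \<one>\<^bsub>A\<^esub> = \<one>\<^bsub>G\<^esub>"
  using hom_one[OF i_hom A.is_group G.is_group] .

lemma A_succ:
  assumes "(a, a') \<in> rA"
  shows "(a \<otimes>\<^bsub>A\<^esub> u, a') \<in> rA\<^sup>="
proof -
  have [simp]: "a \<in> carrier A" "a' \<in> carrier A" using assms A.lt_closed by auto
  have "(u, inv\<^bsub>A\<^esub> a \<otimes>\<^bsub>A\<^esub> a') \<in> rA\<^sup>="
    using assms by (intro u_least) (simp flip: A.lt_iff_pos)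
  from A.le_mult[OF this, of a] show ?thesis by (simp flip: A.m_assoc)
qed

lemma i_succ: "(a, a') \<in> rA \<Longrightarrow> (i a \<otimes>\<^bsub>G\<^esub> i u, i a') \<in> rG\<^sup>="
  using A_succ[of a a'] i_mono[of "a \<otimes>\<^bsub>A\<^esub> u" a'] A.lt_closed[of a a'] by auto

lemma iu_pos: "(\<one>\<^bsub>G\<^esub>, i u) \<in> rG"
  using i_mono[OF u_pos] by simp

lemma floor_decomp:
  assumes "g \<in> carrier G"
  shows "\<exists>a\<in>carrier A. \<exists>t\<in>carrier G. g = i a \<otimes>\<^bsub>G\<^esub> t \<and> (\<one>\<^bsub>G\<^esub>, t) \<in> rG\<^sup>= \<and> (t, i u) \<in> rG"
proof -
  obtain a where a: "a \<in> carrier A" "(i a, g) \<in> rG\<^sup>=" "(g, i a \<otimes>\<^bsub>G\<^esub> i u) \<in> rG"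
    using floor[OF assms] by force
  show ?thesis
  proof (rule bexI[OF _ a(1)], rule bexI[of _ "inv\<^bsub>G\<^esub> i a \<otimes>\<^bsub>G\<^esub> g"], intro conjI)
    show "g = i a \<otimes>\<^bsub>G\<^esub> (inv\<^bsub>G\<^esub> i a \<otimes>\<^bsub>G\<^esub> g)" using a assms by (simp flip: G.m_assoc)
    show "(\<one>\<^bsub>G\<^esub>, inv\<^bsub>G\<^esub> i a \<otimes>\<^bsub>G\<^esub> g) \<in> rG\<^sup>="
      using G.le_mult[OF a(2), of "inv\<^bsub>G\<^esub> i a"] a(1) by simp
    show "(inv\<^bsub>G\<^esub> i a \<otimes>\<^bsub>G\<^esub> g, i u) \<in> rG"
      using G.R_mult[OF a(3), of "inv\<^bsub>G\<^esub> i a"] a(1) by (simp flip: G.m_assoc)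
  qed (use a assms in simp)
qed

text \<open>A nontrivial remainder \<open>t\<close> of the floor decomposition moves down by one
  step to \<open>u\<inverse> t\<close>, and \<open>a\<close> moves up to \<open>a u\<close>; a
  trivial remainder stays.\<close>

lemma ceiling_decomp:
  assumes "g \<in> carrier G"
  shows "\<exists>a\<in>carrier A. \<exists>s\<in>carrier G.
    g = i a \<otimes>\<^bsub>G\<^esub> s \<and> (inv\<^bsub>G\<^esub> i u, s) \<in> rG \<and> (s, \<one>\<^bsub>G\<^esub>) \<in> rG\<^sup>="
proof -
  obtain a t where a: "a \<in> carrier A" "t \<in> carrier G" "g = i a \<otimes>\<^bsub>G\<^esub> t"
      "(\<one>\<^bsub>G\<^esub>, t) \<in> rG\<^sup>=" "(t, i u) \<in> rG"
    using floor_decomp[OF assms] by blast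
  show ?thesis
  proof (cases "t = \<one>\<^bsub>G\<^esub>")
    case True
    then show ?thesis using a iu_pos
      by (intro bexI[of _ a] bexI[of _ "\<one>\<^bsub>G\<^esub>"]) (auto simp: G.inv_pos_iff)
  next
    case False
    then have "(\<one>\<^bsub>G\<^esub>, t) \<in> rG" using a by auto
    from G.R_mult[OF this, of "inv\<^bsub>G\<^esub> i u"] G.R_mult[OF a(5), of "inv\<^bsub>G\<^esub> i u"] a
    show ?thesis
      by (intro bexI[of _ "a \<otimes>\<^bsub>A\<^esub> u"] bexI[of _ "inv\<^bsub>G\<^esub> i u \<otimes>\<^bsub>G\<^esub> t"])
        (auto simp: G.m_assoc simp flip: G.m_assoc[of "i u" "inv\<^bsub>G\<^esub> i u"])
  qed
qed

text \<open>The half-open intervals between consecutive elements of \<open>A\<close> are ordered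
  like \<open>A\<close>: \<open>a t < a u \<le> a' \<le> a' t'\<close>. This makes comparing
  \<open>A\<close>-components first compatible with the order of \<open>G\<close>.\<close>

lemma floor_less:
  assumes "(a, a') \<in> rA" "(t, i u) \<in> rG" "(\<one>\<^bsub>G\<^esub>, t') \<in> rG\<^sup>="
  shows "(i a \<otimes>\<^bsub>G\<^esub> t, i a' \<otimes>\<^bsub>G\<^esub> t') \<in> rG"
proof -
  have [simp]: "a \<in> carrier A" "a' \<in> carrier A" using assms A.lt_closed by auto
  have "(i a \<otimes>\<^bsub>G\<^esub> t, i a \<otimes>\<^bsub>G\<^esub> i u) \<in> rG" using assms G.R_mult by simp
  also have "(i a \<otimes>\<^bsub>G\<^esub> i u, i a') \<in> rG\<^sup>=" using assms i_succ by blast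
  also have "(i a', i a' \<otimes>\<^bsub>G\<^esub> t') \<in> rG\<^sup>=" using G.le_mult[OF assms(3), of "i a'"] by simp
  finally show ?thesis .
qed

text \<open>The mirror image of \<open>floor_less\<close>, with intervals closed at the upper end:
  \<open>a s \<le> a \<le> a' u\<inverse> < a' s'\<close>.\<close>

lemma ceiling_less:
  assumes "(a, a') \<in> rA" "(s, \<one>\<^bsub>G\<^esub>) \<in> rG\<^sup>=" "(inv\<^bsub>G\<^esub> i u, s') \<in> rG"
  shows "(i a \<otimes>\<^bsub>G\<^esub> s, i a' \<otimes>\<^bsub>G\<^esub> s') \<in> rG"
proof -
  have [simp]: "a \<in> carrier A" "a' \<in> carrier A" using assms A.lt_closed by auto
  have ua: "(a \<otimes>\<^bsub>A\<^esub> u, a') \<in> rA\<^sup>=" using A_succ assms by blast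
  \<comment> \<open>Left-invariance does not allow \<open>u\<close> to be moved across on the right;
    the successor property of \<open>u\<close> in \<open>A\<close> is used instead.\<close>
  have "(a, a' \<otimes>\<^bsub>A\<^esub> inv\<^bsub>A\<^esub> u) \<in> rA\<^sup>="
  proof (rule ccontr)
    assume "(a, a' \<otimes>\<^bsub>A\<^esub> inv\<^bsub>A\<^esub> u) \<notin> rA\<^sup>="
    then have "(a' \<otimes>\<^bsub>A\<^esub> inv\<^bsub>A\<^esub> u, a) \<in> rA"
      using A_total[unfolded total_on_def, rule_format, of a "a' \<otimes>\<^bsub>A\<^esub> inv\<^bsub>A\<^esub> u"] by auto
    from A_succ[OF this] have "(a', a) \<in> rA\<^sup>=" by (simp add: A.m_assoc)
    then show False using assms(1) A.le_not_lt by blast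
  qed
  then have "(i a, i a' \<otimes>\<^bsub>G\<^esub> i (inv\<^bsub>A\<^esub> u)) \<in> rG\<^sup>="
    using i_mono[of a "a' \<otimes>\<^bsub>A\<^esub> inv\<^bsub>A\<^esub> u"] by auto
  then have le: "(i a, i a' \<otimes>\<^bsub>G\<^esub> inv\<^bsub>G\<^esub> i u) \<in> rG\<^sup>="
    using group_hom.hom_inv[of A G i u] i_hom A.is_group G.is_group
    by (simp add: group_hom_def group_hom_axioms_def)
  have "(i a \<otimes>\<^bsub>G\<^esub> s, i a) \<in> rG\<^sup>=" using G.le_mult[OF assms(2), of "i a"] by simp
  also note le
  also have "(i a' \<otimes>\<^bsub>G\<^esub> inv\<^bsub>G\<^esub> i u, i a' \<otimes>\<^bsub>G\<^esub> s') \<in> rG" using assms G.R_mult by simp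
  finally show ?thesis .
qed

end

section \<open>Groups acting on lexicographic products\<close>

locale block_action = partial_left_order G r
  for G :: "('g, 'm) monoid_scheme" (structure) and r +
  fixes \<Omega> :: "'w set" and \<sigma> :: "'w \<Rightarrow> 'g \<times> 'b" and B :: "'b set"
    and ltw :: "'w \<Rightarrow> 'w \<Rightarrow> bool" and ltb :: "'b \<Rightarrow> 'b \<Rightarrow> bool"
  assumes \<sigma>_image: "\<sigma> ` \<Omega> = carrier G \<times> B"
    and ltw_total: "v \<in> \<Omega> \<Longrightarrow> w \<in> \<Omega> \<Longrightarrow> v \<noteq> w \<Longrightarrow> ltw v w \<or> ltw w v"
    and ltb_asym: "b \<in> B \<Longrightarrow> c \<in> B \<Longrightarrow> ltb b c \<Longrightarrow> \<not> ltb c b"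
    and \<sigma>_mono: "v \<in> \<Omega> \<Longrightarrow> w \<in> \<Omega> \<Longrightarrow> ltw v w \<Longrightarrow>
      (fst (\<sigma> v), fst (\<sigma> w)) \<in> r \<or> fst (\<sigma> v) = fst (\<sigma> w) \<and> ltb (snd (\<sigma> v)) (snd (\<sigma> w))"
begin

lemma \<sigma>_closed:
  assumes "w \<in> \<Omega>"
  shows "fst (\<sigma> w) \<in> carrier G" "snd (\<sigma> w) \<in> B"
  using imageI[OF assms, of \<sigma>] by (auto simp: \<sigma>_image)

text \<open>The converse of \<open>\<sigma>_mono\<close> follows from totality of \<open>ltw\<close>
  and asymmetry of the lexicographic relation. Hence an order isomorphism has to be checked in one
  direction only.\<close>

lemma ltw_iff:
  assumes "v \<in> \<Omega>" "w \<in> \<Omega>"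
  shows "ltw v w \<longleftrightarrow>
    (fst (\<sigma> v), fst (\<sigma> w)) \<in> r \<or> fst (\<sigma> v) = fst (\<sigma> w) \<and> ltb (snd (\<sigma> v)) (snd (\<sigma> w))"
  using assms \<sigma>_mono[of v w] \<sigma>_mono[of w v] ltw_total[of v w] \<sigma>_closed ltb_asym lt_irrefl lt_trans
  by metis

lemma \<sigma>_bij: "bij_betw \<sigma> \<Omega> (carrier G \<times> B)"
proof (rule bij_betw_imageI)
  show "inj_on \<sigma> \<Omega>"
    using \<sigma>_mono ltw_total \<sigma>_closed ltb_asym lt_irrefl by (intro inj_onI) metis
qed (rule \<sigma>_image)

text \<open>Left multiplication on the first factor, transported through \<open>\<sigma>\<close>.
  The restriction to \<open>\<Omega>\<close> makes it an element of
  \<open>BijGroup \<Omega>\<close>, whose members are extensional.\<close>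

definition act :: "'g \<Rightarrow> 'w \<Rightarrow> 'w" where
  "act g = (\<lambda>w\<in>\<Omega>. inv_into \<Omega> \<sigma> (g \<otimes> fst (\<sigma> w), snd (\<sigma> w)))"

lemma act_closed: "g \<in> carrier G \<Longrightarrow> w \<in> \<Omega> \<Longrightarrow> act g w \<in> \<Omega>"
  unfolding act_def using \<sigma>_closed \<sigma>_image by (auto intro!: inv_into_into)

lemma \<sigma>_act: "g \<in> carrier G \<Longrightarrow> w \<in> \<Omega> \<Longrightarrow> \<sigma> (act g w) = (g \<otimes> fst (\<sigma> w), snd (\<sigma> w))"
  unfolding act_def using \<sigma>_closed \<sigma>_image by (auto intro!: f_inv_into_f)

lemma act_eqI:
  assumes "v \<in> \<Omega>" "w \<in> \<Omega>" "\<sigma> v = (g \<otimes> fst (\<sigma> w), snd (\<sigma> w))"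
  shows "act g w = v"
  using assms \<sigma>_bij by (simp add: act_def bij_betw_def flip: assms(3))

lemma act_Bij:
  assumes "g \<in> carrier G"
  shows "act g \<in> Bij \<Omega>"
proof -
  have "bij_betw (act g) \<Omega> \<Omega>"
  proof (rule bij_betw_byWitness[where f' = "act (inv g)"])
    show "\<forall>w\<in>\<Omega>. act (inv g) (act g w) = w" "\<forall>w\<in>\<Omega>. act g (act (inv g) w) = w"
      using assms by (auto intro!: act_eqI simp: act_closed \<sigma>_act \<sigma>_closed simp flip: m_assoc)
  qed (use assms act_closed in auto)
  then show ?thesis by (simp add: Bij_def act_def)
qed

lemma act_hom: "act \<in> hom G (BijGroup \<Omega>)"
proof (rule homI)
  show "act g \<in> carrier (BijGroup \<Omega>)" if "g \<in> carrier G" for g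
    using that by (simp add: BijGroup_def act_Bij)
  fix g h assume gh: "g \<in> carrier G" "h \<in> carrier G"
  have "act (g \<otimes> h) w = compose \<Omega> (act g) (act h) w" for w
  proof (cases "w \<in> \<Omega>")
    case True
    with gh show ?thesis
      by (auto intro!: act_eqI simp: compose_def act_closed \<sigma>_act \<sigma>_closed m_assoc)
  qed (simp add: compose_def act_def)
  then show "act (g \<otimes> h) = act g \<otimes>\<^bsub>BijGroup \<Omega>\<^esub> act h"
    using gh by (auto simp: BijGroup_def act_Bij)
qed

lemma act_mono:
  assumes "g \<in> carrier G" "v \<in> \<Omega>" "w \<in> \<Omega>" "ltw v w"
  shows "ltw (act g v) (act g w)"
  using assms by (auto simp: ltw_iff act_closed \<sigma>_act intro: R_mult)

end

section \<open>Alternating words and their lexicographic order\<close>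

primrec alternating :: "'s set \<Rightarrow> 't set \<Rightarrow> bool \<Rightarrow> ('s + 't) list \<Rightarrow> bool" where
  "alternating S T left [] \<longleftrightarrow> True"
| "alternating S T left (x # w) \<longleftrightarrow>
    (case x of Inl s \<Rightarrow> left \<and> s \<in> S \<and> alternating S T False w
             | Inr t \<Rightarrow> \<not> left \<and> t \<in> T \<and> alternating S T True w)"

fun letter_less :: "'s rel \<Rightarrow> 't rel \<Rightarrow> 's + 't \<Rightarrow> 's + 't \<Rightarrow> bool" where
  "letter_less r q (Inl s) (Inl s') \<longleftrightarrow> (s, s') \<in> r"
| "letter_less r q (Inl s) (Inr t) \<longleftrightarrow> True"
| "letter_less r q (Inr t) (Inl s) \<longleftrightarrow> False"
| "letter_less r q (Inr t) (Inr t') \<longleftrightarrow> (t, t') \<in> q"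

text \<open>
  The end of a word is placed between the letters of the two kinds, because below the letters
  from the left are negative and those from the right are positive.
\<close>

fun word_less :: "'s rel \<Rightarrow> 't rel \<Rightarrow> ('s + 't) list \<Rightarrow> ('s + 't) list \<Rightarrow> bool" where
  "word_less r q [] [] \<longleftrightarrow> False"
| "word_less r q [] (y # w) \<longleftrightarrow> \<not> isl y"
| "word_less r q (x # v) [] \<longleftrightarrow> isl x"
| "word_less r q (x # v) (y # w) \<longleftrightarrow> letter_less r q x y \<or> x = y \<and> word_less r q v w"

lemma letter_less_irrefl: "irrefl r \<Longrightarrow> irrefl q \<Longrightarrow> \<not> letter_less r q x x"
  by (cases x) (auto simp: irrefl_def)

lemma letter_less_trans:
  "trans r \<Longrightarrow> trans q \<Longrightarrow> letter_less r q x y \<Longrightarrow> letter_less r q y z \<Longrightarrow> letter_less r q x z"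
  by (cases x; cases y; cases z) (auto dest: transD)

lemma word_less_irrefl: "irrefl r \<Longrightarrow> irrefl q \<Longrightarrow> \<not> word_less r q w w"
  by (induction w) (auto simp: letter_less_irrefl)

lemma letter_less_isl:
  "isl x \<Longrightarrow> \<not> isl y \<Longrightarrow> letter_less r q x y"
  "letter_less r q x y \<Longrightarrow> isl y \<Longrightarrow> isl x"
  "letter_less r q x y \<Longrightarrow> \<not> isl x \<Longrightarrow> \<not> isl y"
  by (cases x; cases y; simp)+

lemma word_less_trans:
  assumes "trans r" "trans q"
  shows "word_less r q u v \<Longrightarrow> word_less r q v w \<Longrightarrow> word_less r q u w"
proof (induction u arbitrary: v w)
  case Nil
  then show ?case by (cases v; cases w) (auto dest: letter_less_isl)
next
  case (Cons x u)
  show ?case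
  proof (cases v; cases w)
    fix y v' z w' assume vw: "v = y # v'" "w = z # w'"
    consider "letter_less r q x z" | "x = z" "word_less r q u v'" "word_less r q v' w'"
      using Cons.prems letter_less_trans[OF assms] by (auto simp: vw)
    then show ?thesis using Cons.IH by cases (auto simp: vw)
  qed (use Cons.prems in \<open>auto dest: letter_less_isl intro: letter_less_isl\<close>)
qed

text \<open>The flags \<open>d\<close> and \<open>e\<close> are independent, so words of different
  kinds are compared too. Alternation serves only to keep the letters in \<open>S\<close> and
  \<open>T\<close>, where \<open>r\<close> and \<open>q\<close> are total.\<close>

lemma word_less_total:
  assumes "total_on S r" "total_on T q"
  shows "alternating S T d v \<Longrightarrow> alternating S T e w \<Longrightarrow> v \<noteq> w \<Longrightarrow>
    word_less r q v w \<or> word_less r q w v"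
proof (induction v arbitrary: d e w)
  case Nil
  then show ?case by (cases w) auto
next
  case (Cons x v)
  show ?case
  proof (cases w)
    case Nil
    then show ?thesis by auto
  next
    case w: (Cons y w')
    have "\<exists>d. alternating S T d v" "\<exists>e. alternating S T e w'"
      using Cons.prems by (auto simp: w split: sum.splits)
    then have "v = w' \<or> word_less r q v w' \<or> word_less r q w' v"
      using Cons.IH by blast
    then show ?thesis
      using Cons.prems assms by (cases x; cases y) (auto simp: w total_on_def)
  qed
qed

text \<open>As \<open>r\<close> is total, a monotone \<open>f\<close> also reflects strict
  inequalities, so a positive \<open>f x\<close> comes from a positive \<open>x\<close>. This yields
  the images of \<open>A\<close>, \<open>G\<close> and \<open>H\<close> in \<open>X\<close>.\<close>

lemma discrete_subgroup_image:
  assumes "partial_left_order G r" "partial_left_order X R" "total_on (carrier G) r"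
    and f: "f \<in> hom G X" and mono: "\<And>x y. (x, y) \<in> r \<Longrightarrow> (f x, f y) \<in> R"
    and p: "is_min_positive G r p"
  shows "discrete_subgroup X R (f ` carrier G) (f p)"
proof -
  interpret G: partial_left_order G r by fact
  interpret R: partial_left_order X R by fact
  interpret f: group_hom G X f
    using f G.is_group R.is_group by (simp add: group_hom_def group_hom_axioms_def)
  have trichotomy: "x = y \<or> (x, y) \<in> r \<or> (y, x) \<in> r" if "x \<in> carrier G" "y \<in> carrier G" for x y
    using that assms(3) by (auto simp: total_on_def)
  have one: "f \<one>\<^bsub>G\<^esub> = \<one>\<^bsub>X\<^esub>" by simp
  show ?thesis
  proof (intro discrete_subgroup.intro discrete_subgroup_axioms.intro assms(2))
    show "subgroup (f ` carrier G) X" by (rule f.img_is_subgroup)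
    show "total_on (f ` carrier G) R"
      using trichotomy mono unfolding total_on_def by (metis imageE)
    show "f p \<in> f ` carrier G" using p G.lt_closed by (auto simp: is_min_positive_def)
    show "(\<one>\<^bsub>X\<^esub>, f p) \<in> R" using p mono one by (metis is_min_positive_def)
    show "(f p, y) \<in> R\<^sup>=" if y: "y \<in> f ` carrier G" "(\<one>\<^bsub>X\<^esub>, y) \<in> R" for y
    proof -
      obtain x where x: "x \<in> carrier G" "y = f x" using y by blast
      have "(x, \<one>\<^bsub>G\<^esub>) \<notin> r" "x \<noteq> \<one>\<^bsub>G\<^esub>"
        using mono[of x "\<one>\<^bsub>G\<^esub>"] y x R.lt_irrefl R.lt_trans one by metis+
      then have "(\<one>\<^bsub>G\<^esub>, x) \<in> r" using trichotomy[of "\<one>\<^bsub>G\<^esub>" x] x by simp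
      then show ?thesis using p mono x by (auto simp: is_min_positive_def)
    qed
  qed
qed

section \<open>Construction of the order\<close>

text \<open>
  The universal property is an assumption, so that the locale can also be interpreted with \<open>G\<close>
  and \<open>H\<close> exchanged. An assumption cannot quantify over types, hence the fixed type of \<open>K\<close>, which is
  the one used for the action on words.
\<close>

locale amalgam =
  G: stepped_extension A rA G rG i u + H: stepped_extension A rA H rH j u + X: group X
  for A :: "('a, 'l) monoid_scheme" and rA and G :: "('g, 'm) monoid_scheme" and rG
    and i :: "'a \<Rightarrow> 'g" and u :: 'a
    and H :: "('h, 'n) monoid_scheme" and rH and j :: "'a \<Rightarrow> 'h"
    and X :: "('x, 'k) monoid_scheme" +
  fixes inG :: "'g \<Rightarrow> 'x" and inH :: "'h \<Rightarrow> 'x" and p :: 'g and q :: 'h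
  assumes inG_hom: "inG \<in> hom G X" and inH_hom: "inH \<in> hom H X"
    and inG_i: "a \<in> carrier A \<Longrightarrow> inG (i a) = inH (j a)"
    and generated: "\<one>\<^bsub>X\<^esub> \<in> Y \<Longrightarrow>
      (\<And>g y. g \<in> carrier G \<Longrightarrow> y \<in> carrier X \<Longrightarrow> y \<in> Y \<Longrightarrow> inG g \<otimes>\<^bsub>X\<^esub> y \<in> Y) \<Longrightarrow>
      (\<And>h y. h \<in> carrier H \<Longrightarrow> y \<in> carrier X \<Longrightarrow> y \<in> Y \<Longrightarrow> inH h \<otimes>\<^bsub>X\<^esub> y \<in> Y) \<Longrightarrow>
      carrier X \<subseteq> Y"
    and universal: "group (K :: ('a \<times> ('g + 'h) list \<Rightarrow> 'a \<times> ('g + 'h) list) monoid) \<Longrightarrow>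
      f \<in> hom G K \<Longrightarrow> k \<in> hom H K \<Longrightarrow> (\<And>a. a \<in> carrier A \<Longrightarrow> f (i a) = k (j a)) \<Longrightarrow>
      \<exists>\<phi>\<in>hom X K. (\<forall>g\<in>carrier G. \<phi> (inG g) = f g) \<and> (\<forall>h\<in>carrier H. \<phi> (inH h) = k h)"
    and p_min: "is_min_positive G rG p" and q_min: "is_min_positive H rH q"
begin

section \<open>Points and their coordinates for the two factors\<close>

definition S where "S = {s. (inv\<^bsub>G\<^esub> i u, s) \<in> rG \<and> (s, \<one>\<^bsub>G\<^esub>) \<in> rG}"
definition T where "T = {t. (\<one>\<^bsub>H\<^esub>, t) \<in> rH \<and> (t, j u) \<in> rH}"
definition wordsB where "wordsB = {w. alternating S T False w}"
definition wordsC where "wordsC = {w. alternating S T True w}"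
text \<open>Formal normal forms \<open>a w\<close>, kept as pairs because nothing is known yet about
  uniqueness of normal forms in \<open>X\<close>.\<close>

definition points where "points = carrier A \<times> (wordsB \<union> wordsC)"

definition point_less where
  "point_less v w \<longleftrightarrow>
    (fst v, fst w) \<in> rA \<or> fst v = fst w \<and> word_less rG rH (snd v) (snd w)"

text \<open>The coordinates in which \<open>G\<close> acts by left multiplication: the leading
  letter from \<open>G\<close> is absorbed into the first component.\<close>

fun blockG where
  "blockG (a, Inl s # w) = (i a \<otimes>\<^bsub>G\<^esub> s, w)"
| "blockG (a, w) = (i a, w)"

fun blockH where
  "blockH (a, Inr t # w) = (j a \<otimes>\<^bsub>H\<^esub> t, w)"
| "blockH (a, w) = (j a, w)"

lemma S_closed: "S \<subseteq> carrier G" and T_closed: "T \<subseteq> carrier H"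
  using G.G.lt_closed H.G.lt_closed by (auto simp: S_def T_def)

lemma letters_total: "total_on S rG" "total_on T rH"
  using G.G_total H.G_total S_closed T_closed by (auto intro: total_on_subset)

lemma point_less_total:
  assumes "v \<in> points" "w \<in> points" "v \<noteq> w"
  shows "point_less v w \<or> point_less w v"
  using assms G.A_total word_less_total[OF letters_total]
  by (auto simp: points_def point_less_def wordsB_def wordsC_def total_on_def prod_eq_iff; blast)

lemma word_less_facts:
  "\<not> word_less rG rH v v"
  "word_less rG rH v w \<Longrightarrow> word_less rG rH w w' \<Longrightarrow> word_less rG rH v w'"
  using word_less_irrefl word_less_trans G.G.R_irrefl H.G.R_irrefl G.G.R_trans H.G.R_trans by blast+

lemma word_less_asym: "word_less rG rH v w \<Longrightarrow> \<not> word_less rG rH w v"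
  using word_less_facts by blast

lemma point_less_irrefl: "\<not> point_less v v"
  by (simp add: point_less_def G.A.lt_irrefl word_less_facts)

lemma point_less_trans: "point_less v w \<Longrightarrow> point_less w x \<Longrightarrow> point_less v x"
  by (auto simp: point_less_def intro: G.A.lt_trans word_less_facts)

text \<open>Surjectivity is the ceiling decomposition. A trivial representative corresponds to a
  word without a leading letter from \<open>G\<close>, which is why \<open>S\<close> excludes
  1.\<close>

lemma blockG_image: "blockG ` points = carrier G \<times> wordsB"
proof (intro equalityI subsetI)
  fix y assume "y \<in> blockG ` points"
  then obtain a w where "y = blockG (a, w)" "a \<in> carrier A" "w \<in> wordsB \<union> wordsC"
    by (auto simp: points_def)
  then show "y \<in> carrier G \<times> wordsB"
    using S_closed by (cases "(a, w)" rule: blockG.cases) (auto simp: wordsB_def wordsC_def)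
next
  fix y assume "y \<in> carrier G \<times> wordsB"
  then obtain g w where y: "y = (g, w)" "g \<in> carrier G" "w \<in> wordsB" by blast
  obtain a s where a: "a \<in> carrier A" "s \<in> carrier G" "g = i a \<otimes>\<^bsub>G\<^esub> s"
      "(inv\<^bsub>G\<^esub> i u, s) \<in> rG" "(s, \<one>\<^bsub>G\<^esub>) \<in> rG\<^sup>="
    using G.ceiling_decomp[OF y(2)] by blast
  show "y \<in> blockG ` points"
  proof (cases "s = \<one>\<^bsub>G\<^esub>")
    case True
    have "blockG (a, w) = (i a, w)"
      using y by (cases "(a, w)" rule: blockG.cases) (auto simp: wordsB_def)
    then show ?thesis using a y True
      by (intro image_eqI[of _ _ "(a, w)"]) (auto simp: points_def)
  next
    case False
    then show ?thesis using a y
      by (intro image_eqI[of _ _ "(a, Inl s # w)"])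
        (auto simp: points_def wordsB_def wordsC_def S_def)
  qed
qed

lemma blockH_image: "blockH ` points = carrier H \<times> wordsC"
proof (intro equalityI subsetI)
  fix y assume "y \<in> blockH ` points"
  then obtain a w where "y = blockH (a, w)" "a \<in> carrier A" "w \<in> wordsB \<union> wordsC"
    by (auto simp: points_def)
  then show "y \<in> carrier H \<times> wordsC"
    using T_closed by (cases "(a, w)" rule: blockH.cases) (auto simp: wordsB_def wordsC_def)
next
  fix y assume "y \<in> carrier H \<times> wordsC"
  then obtain h w where y: "y = (h, w)" "h \<in> carrier H" "w \<in> wordsC" by blast
  obtain a t where a: "a \<in> carrier A" "t \<in> carrier H" "h = j a \<otimes>\<^bsub>H\<^esub> t"
      "(\<one>\<^bsub>H\<^esub>, t) \<in> rH\<^sup>=" "(t, j u) \<in> rH"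
    using H.floor_decomp[OF y(2)] by blast
  show "y \<in> blockH ` points"
  proof (cases "t = \<one>\<^bsub>H\<^esub>")
    case True
    have "blockH (a, w) = (j a, w)"
      using y by (cases "(a, w)" rule: blockH.cases) (auto simp: wordsC_def)
    then show ?thesis using a y True
      by (intro image_eqI[of _ _ "(a, w)"]) (auto simp: points_def)
  next
    case False
    then show ?thesis using a y
      by (intro image_eqI[of _ _ "(a, Inr t # w)"])
        (auto simp: points_def wordsB_def wordsC_def T_def)
  qed
qed

text \<open>If the \<open>A\<close>-components differ, \<open>ceiling_less\<close> decides. If they
  agree, the first letters from \<open>G\<close> are compared, and the rest of the word is compared
  when these agree.\<close>

lemma blockG_mono:
  assumes "v \<in> points" "w \<in> points" "point_less v w"
  shows "(fst (blockG v), fst (blockG w)) \<in> rG \<or>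
    fst (blockG v) = fst (blockG w) \<and> word_less rG rH (snd (blockG v)) (snd (blockG w))"
proof -
  \<comment> \<open>The default letter 1 merges the clauses of \<open>blockG\<close>. It lies above
    all of \<open>S\<close>, just as \<open>word_less\<close> puts a word without a leading letter
    from \<open>G\<close> above those with one.\<close>
  define hd' where "hd' x = (case x of Inl s # _ \<Rightarrow> s | _ \<Rightarrow> \<one>\<^bsub>G\<^esub>)" for x :: "('g + 'h) list"
  define tl' where "tl' x = (case x of Inl s # y \<Rightarrow> y | _ \<Rightarrow> x)" for x :: "('g + 'h) list"
  have bounds: "(inv\<^bsub>G\<^esub> i u, hd' (snd x)) \<in> rG \<and> (hd' (snd x), \<one>\<^bsub>G\<^esub>) \<in> rG\<^sup>="
    and block: "blockG x = (i (fst x) \<otimes>\<^bsub>G\<^esub> hd' (snd x), tl' (snd x))"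
    if "x \<in> points" for x
    using that G.iu_pos
    by (cases x rule: blockG.cases;
        auto simp: points_def wordsB_def wordsC_def S_def hd'_def tl'_def G.G.inv_pos_iff)+
  consider "(fst v, fst w) \<in> rA" | "fst v = fst w" "word_less rG rH (snd v) (snd w)"
    using assms by (auto simp: point_less_def)
  then show ?thesis
  proof cases
    case 1
    then show ?thesis
      using G.ceiling_less bounds[OF assms(1)] bounds[OF assms(2)]
      by (simp add: block assms)
  next
    case 2
    have "(hd' (snd v), hd' (snd w)) \<in> rG \<or>
        hd' (snd v) = hd' (snd w) \<and> word_less rG rH (tl' (snd v)) (tl' (snd w))"
      using assms(1,2) 2(2)
      by (cases v rule: blockG.cases; cases w rule: blockG.cases)
        (auto simp: points_def wordsB_def wordsC_def S_def hd'_def tl'_def)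
    then show ?thesis
      using 2 assms G.G.R_mult by (auto simp: block points_def)
  qed
qed

lemma blockH_mono:
  assumes "v \<in> points" "w \<in> points" "point_less v w"
  shows "(fst (blockH v), fst (blockH w)) \<in> rH \<or>
    fst (blockH v) = fst (blockH w) \<and> word_less rG rH (snd (blockH v)) (snd (blockH w))"
proof -
  \<comment> \<open>Here the default 1 lies below all of \<open>T\<close>, in agreement with
    \<open>word_less\<close>.\<close>
  define hd' where "hd' x = (case x of Inr t # _ \<Rightarrow> t | _ \<Rightarrow> \<one>\<^bsub>H\<^esub>)" for x :: "('g + 'h) list"
  define tl' where "tl' x = (case x of Inr t # y \<Rightarrow> y | _ \<Rightarrow> x)" for x :: "('g + 'h) list"
  have bounds: "(\<one>\<^bsub>H\<^esub>, hd' (snd x)) \<in> rH\<^sup>= \<and> (hd' (snd x), j u) \<in> rH"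
    and block: "blockH x = (j (fst x) \<otimes>\<^bsub>H\<^esub> hd' (snd x), tl' (snd x))"
    if "x \<in> points" for x
    using that H.iu_pos
    by (cases x rule: blockH.cases;
        auto simp: points_def wordsB_def wordsC_def T_def hd'_def tl'_def)+
  consider "(fst v, fst w) \<in> rA" | "fst v = fst w" "word_less rG rH (snd v) (snd w)"
    using assms by (auto simp: point_less_def)
  then show ?thesis
  proof cases
    case 1
    then show ?thesis
      using H.floor_less bounds[OF assms(1)] bounds[OF assms(2)]
      by (simp add: block assms)
  next
    case 2
    have "(hd' (snd v), hd' (snd w)) \<in> rH \<or>
        hd' (snd v) = hd' (snd w) \<and> word_less rG rH (tl' (snd v)) (tl' (snd w))"
      using assms(1,2) 2(2)
      by (cases v rule: blockH.cases; cases w rule: blockH.cases)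
        (auto simp: points_def wordsB_def wordsC_def T_def hd'_def tl'_def)
    then show ?thesis
      using 2 assms H.G.R_mult by (auto simp: block points_def)
  qed
qed

sublocale actG: block_action G rG points blockG wordsB point_less "word_less rG rH"
  by unfold_locales (auto simp: blockG_image point_less_total word_less_asym blockG_mono)

sublocale actH: block_action H rH points blockH wordsC point_less "word_less rG rH"
  by unfold_locales (auto simp: blockH_image point_less_total word_less_asym blockH_mono)

text \<open>In both coordinate systems \<open>a\<close> multiplies the \<open>A\<close>-component
  from the left and leaves the word unchanged. This is the compatibility demanded by the universal
  property.\<close>

lemma act_i_eq_act_j:
  assumes "a \<in> carrier A"
  shows "actG.act (i a) = actH.act (j a)"
proof
  fix x
  show "actG.act (i a) x = actH.act (j a) x"
  proof (cases "x \<in> points")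
    case True
    obtain b w where x: "x = (b, w)" by force
    have ab: "(a \<otimes>\<^bsub>A\<^esub> b, w) \<in> points" "b \<in> carrier A"
      using True assms by (auto simp: x points_def)
    have "blockG (a \<otimes>\<^bsub>A\<^esub> b, w) = (i a \<otimes>\<^bsub>G\<^esub> fst (blockG x), snd (blockG x))"
      using True ab assms S_closed unfolding x
      by (cases "(b, w)" rule: blockG.cases)
        (auto simp: points_def wordsB_def wordsC_def G.G.m_assoc)
    then have "actG.act (i a) x = (a \<otimes>\<^bsub>A\<^esub> b, w)"
      using True ab by (intro actG.act_eqI) auto
    moreover have "blockH (a \<otimes>\<^bsub>A\<^esub> b, w) = (j a \<otimes>\<^bsub>H\<^esub> fst (blockH x), snd (blockH x))"
      using True ab assms T_closed unfolding x
      by (cases "(b, w)" rule: blockH.cases)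
        (auto simp: points_def wordsB_def wordsC_def H.G.m_assoc)
    then have "actH.act (j a) x = (a \<otimes>\<^bsub>A\<^esub> b, w)"
      using True ab by (intro actH.act_eqI) auto
    ultimately show ?thesis by simp
  qed (simp add: actG.act_def actH.act_def)
qed


section \<open>The order on the amalgamated product\<close>

lemma inG_closed [simp]: "g \<in> carrier G \<Longrightarrow> inG g \<in> carrier X"
  and inG_mult: "g \<in> carrier G \<Longrightarrow> g' \<in> carrier G \<Longrightarrow> inG (g \<otimes>\<^bsub>G\<^esub> g') = inG g \<otimes>\<^bsub>X\<^esub> inG g'"
  using inG_hom by (auto simp: hom_def)

lemma inH_closed [simp]: "h \<in> carrier H \<Longrightarrow> inH h \<in> carrier X"
  and inH_mult: "h \<in> carrier H \<Longrightarrow> h' \<in> carrier H \<Longrightarrow> inH (h \<otimes>\<^bsub>H\<^esub> h') = inH h \<otimes>\<^bsub>X\<^esub> inH h'"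
  using inH_hom by (auto simp: hom_def)

lemma group_homs: "group_hom G X inG" "group_hom H X inH"
  using inG_hom inH_hom G.G.is_group H.G.is_group X.is_group
  by (simp_all add: group_hom_def group_hom_axioms_def)

lemmas inG_one = group_hom.hom_one[OF group_homs(1)]
lemmas inH_one = group_hom.hom_one[OF group_homs(2)]
lemmas inG_inv = group_hom.hom_inv[OF group_homs(1)]
lemmas inH_inv = group_hom.hom_inv[OF group_homs(2)]

lemma p_closed [simp]: "p \<in> carrier G" and q_closed [simp]: "q \<in> carrier H"
  using p_min q_min G.G.lt_closed H.G.lt_closed by (auto simp: is_min_positive_def)

abbreviation z where "z \<equiv> inH q \<otimes>\<^bsub>X\<^esub> inv\<^bsub>X\<^esub> (inG (i u)) \<otimes>\<^bsub>X\<^esub> inG p"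

abbreviation extends where
  "extends R \<equiv> rG \<subseteq> inv_image R inG \<and> rH \<subseteq> inv_image R inH"

text \<open>The universal property turns the two actions into an action \<open>\<phi>\<close> of
  \<open>X\<close>, and elements of \<open>X\<close> are compared by where they move a base point.
  Distinct elements moving it to the same point are incomparable, so at this stage the order is only
  partial.\<close>

lemma ex_extending_order: "\<exists>R. partial_left_order X R \<and> extends R \<and> (\<one>\<^bsub>X\<^esub>, z) \<in> R"
proof -
  obtain \<phi> where \<phi>: "\<phi> \<in> hom X (BijGroup points)"
      and \<phi>G: "\<And>g. g \<in> carrier G \<Longrightarrow> \<phi> (inG g) = actG.act g"
      and \<phi>H: "\<And>h. h \<in> carrier H \<Longrightarrow> \<phi> (inH h) = actH.act h"
    using universal[OF group_BijGroup actG.act_hom actH.act_hom act_i_eq_act_j] by blast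
  have \<phi>_Bij: "\<phi> x \<in> Bij points" if "x \<in> carrier X" for x
    using \<phi> that by (auto simp: hom_def BijGroup_def)
  then have \<phi>_closed: "\<phi> x v \<in> points" if "x \<in> carrier X" "v \<in> points" for x v
    using that Bij_imp_funcset by blast
  have \<phi>_mult: "\<phi> (x \<otimes>\<^bsub>X\<^esub> y) v = \<phi> x (\<phi> y v)"
    if "x \<in> carrier X" "y \<in> carrier X" "v \<in> points" for x y v
    using hom_mult[OF \<phi> that(1,2)] that \<phi>_Bij by (simp add: BijGroup_def compose_def)
  have \<phi>_one: "\<phi> \<one>\<^bsub>X\<^esub> v = v" if "v \<in> points" for v
    using hom_one[OF \<phi> X.is_group group_BijGroup] that by (simp add: BijGroup_def)
  have \<phi>_mono: "point_less (\<phi> x v) (\<phi> x w)"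
    if "x \<in> carrier X" "v \<in> points" "w \<in> points" "point_less v w" for x v w
  proof -
    \<comment> \<open>The elements that act monotonically on this pair contain 1 and are closed
      under left multiplication by the generators.\<close>
    have "carrier X \<subseteq> {x. point_less (\<phi> x v) (\<phi> x w)}"
      using that(2-4)
      by (intro generated)
        (simp_all add: \<phi>_one \<phi>_mult \<phi>G \<phi>H actG.act_mono actH.act_mono \<phi>_closed)
    with that(1) show ?thesis by blast
  qed
  define base :: "'a \<times> ('g + 'h) list" where "base = (\<one>\<^bsub>A\<^esub>, [])"
  have base: "base \<in> points" by (simp add: base_def points_def wordsB_def)
  have block_base: "blockG base = (\<one>\<^bsub>G\<^esub>, [])" "blockH base = (\<one>\<^bsub>H\<^esub>, [])"
    by (simp_all add: base_def)
  define R where "R = {(x, y). x \<in> carrier X \<and> y \<in> carrier X \<and> point_less (\<phi> x base) (\<phi> y base)}"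
  have R: "partial_left_order X R"
  proof unfold_locales
    show "R \<subseteq> carrier X \<times> carrier X" by (auto simp: R_def)
    show "trans R" by (rule transI) (auto simp: R_def intro: point_less_trans)
    show "irrefl R" by (rule irreflI) (auto simp: R_def point_less_irrefl)
    show "(x \<otimes>\<^bsub>X\<^esub> a, x \<otimes>\<^bsub>X\<^esub> b) \<in> R" if "(a, b) \<in> R" "x \<in> carrier X" for a b x
      using that base by (auto simp: R_def \<phi>_mult \<phi>_mono \<phi>_closed)
  qed
  interpret R: partial_left_order X R by (rule R)
  have "extends R"
  proof (intro conjI subrelI)
    fix g g' assume gg': "(g, g') \<in> rG"
    then have "g \<in> carrier G" "g' \<in> carrier G" using G.G.lt_closed by auto
    with gg' base show "(g, g') \<in> inv_image R inG"
      by (simp add: R_def \<phi>G actG.ltw_iff actG.act_closed actG.\<sigma>_act block_base)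
  next
    fix h h' assume hh': "(h, h') \<in> rH"
    then have "h \<in> carrier H" "h' \<in> carrier H" using H.G.lt_closed by auto
    with hh' base show "(h, h') \<in> inv_image R inH"
      by (simp add: R_def \<phi>H actH.ltw_iff actH.act_closed actH.\<sigma>_act block_base)
  qed
  \<comment> \<open>Positivity of \<open>z\<close>, translated by \<open>inv q\<close>. Both sides
    lie in a single factor, so their images of the base point are found from block coordinates; the
    \<open>A\<close>-components, below 1 and at least 1, already separate them.\<close>
  moreover have "(inv\<^bsub>X\<^esub> inH q, inv\<^bsub>X\<^esub> inG (i u) \<otimes>\<^bsub>X\<^esub> inG p) \<in> R"
  proof -
    define g where "g = inv\<^bsub>G\<^esub> i u \<otimes>\<^bsub>G\<^esub> p"
    define h where "h = inv\<^bsub>H\<^esub> q"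
    have gh [simp]: "g \<in> carrier G" "h \<in> carrier H" by (simp_all add: g_def h_def)
    obtain a v where av: "actG.act g base = (a, v)" by force
    obtain b w where bw: "actH.act h base = (b, w)" by force
    have pts: "(a, v) \<in> points" "(b, w) \<in> points"
      using actG.act_closed[OF gh(1) base] actH.act_closed[OF gh(2) base] by (simp_all add: av bw)
    have block: "blockG (a, v) = (g, [])" "blockH (b, w) = (h, [])"
      using actG.\<sigma>_act[OF gh(1) base] actH.\<sigma>_act[OF gh(2) base]
      by (simp_all add: av bw block_base)
    have "(h, \<one>\<^bsub>H\<^esub>) \<in> rH"
      using q_min by (simp add: h_def is_min_positive_def H.G.inv_pos_iff)
    then have "point_less (b, w) base"
      using pts base by (simp add: actH.ltw_iff block block_base)
    \<comment> \<open>If \<open>b\<close> were 1, \<open>w\<close> would be below the empty word and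
      start in \<open>G\<close>; then \<open>blockH\<close> would leave it as a nonempty
      remainder.\<close>
    then have "(b, \<one>\<^bsub>A\<^esub>) \<in> rA"
      using block(2) by (cases "(b, w)" rule: blockH.cases) (auto simp: point_less_def base_def)
    moreover have "(\<one>\<^bsub>A\<^esub>, a) \<in> rA\<^sup>="
    proof -
      have "(inv\<^bsub>G\<^esub> i u, g) \<in> rG"
        using p_min by (simp add: g_def is_min_positive_def G.G.lt_mult_right)
      moreover have "i (inv\<^bsub>A\<^esub> u) = inv\<^bsub>G\<^esub> i u"
        using group_hom.hom_inv[of A G i u] G.i_hom G.A.is_group G.G.is_group
        by (simp add: group_hom_def group_hom_axioms_def)
      moreover have "(inv\<^bsub>A\<^esub> u, []) \<in> points" by (simp add: points_def wordsB_def)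
      ultimately have "point_less (inv\<^bsub>A\<^esub> u, []) (a, v)"
        using pts by (simp add: actG.ltw_iff block)
      \<comment> \<open>Likewise, \<open>a = inv u\<close> would need a word \<open>v\<close>
        starting in \<open>H\<close>, which \<open>blockG\<close> does not remove.\<close>
      then have "(inv\<^bsub>A\<^esub> u, a) \<in> rA"
        using block(1) by (cases "(a, v)" rule: blockG.cases) (auto simp: point_less_def)
      from G.A_succ[OF this] show ?thesis by simp
    qed
    ultimately have "point_less (b, w) (a, v)"
      using G.A.lt_le_trans by (auto simp: point_less_def)
    then show ?thesis
      by (simp add: R_def av bw \<phi>G \<phi>H flip: inH_inv inG_inv inG_mult g_def h_def)
  qed
  then have "(\<one>\<^bsub>X\<^esub>, z) \<in> R"
    using R.lt_iff_pos[of "inv\<^bsub>X\<^esub> inH q" "inv\<^bsub>X\<^esub> inG (i u) \<otimes>\<^bsub>X\<^esub> inG p"]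
    by (simp add: X.m_assoc)
  ultimately show ?thesis using R by blast
qed

text \<open>Makes the earlier analysis available for any such partial order, in particular for an
  intersection of two. The decompositions along \<open>A\<close> are transported by
  \<open>inG\<close> and \<open>inH\<close>.\<close>

lemma order_of_extends:
  assumes "partial_left_order X R" "extends R" "(\<one>\<^bsub>X\<^esub>, z) \<in> R"
  shows "amalgam_order X R (inG ` i ` carrier A) (inG (i u)) (inG ` carrier G) (inG p)
    (inH ` carrier H) (inH q)"
proof -
  interpret R: partial_left_order X R by fact
  have exG: "(inG g, inG g') \<in> R" if "(g, g') \<in> rG" for g g'
    using assms(2) that by (auto simp: in_inv_image)
  have exH: "(inH h, inH h') \<in> R" if "(h, h') \<in> rH" for h h'
    using assms(2) that by (auto simp: in_inv_image)
  have A: "discrete_subgroup X R (inG ` i ` carrier A) (inG (i u))"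
    using discrete_subgroup_image[OF G.A.partial_left_order_axioms assms(1) G.A_total
        hom_compose[OF G.i_hom inG_hom] _ G.u_min] exG G.i_mono
    by (simp add: image_comp)
  have G: "discrete_subgroup X R (inG ` carrier G) (inG p)"
    using discrete_subgroup_image[OF G.G.partial_left_order_axioms assms(1) G.G_total
        inG_hom exG p_min] .
  have H: "discrete_subgroup X R (inH ` carrier H) (inH q)"
    using discrete_subgroup_image[OF H.G.partial_left_order_axioms assms(1) H.G_total
        inH_hom exH q_min] .
  have G_decomp: "\<exists>a\<in>inG ` i ` carrier A. \<exists>s\<in>inG ` carrier G. x = a \<otimes>\<^bsub>X\<^esub> s \<and>
      (inv\<^bsub>X\<^esub> inG (i u), s) \<in> R \<and> (s, \<one>\<^bsub>X\<^esub>) \<in> R\<^sup>=" if x: "x \<in> inG ` carrier G" for x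
  proof -
    obtain g where g: "g \<in> carrier G" "x = inG g" using x by blast
    obtain a s where as: "a \<in> carrier A" "s \<in> carrier G" "g = i a \<otimes>\<^bsub>G\<^esub> s"
        "(inv\<^bsub>G\<^esub> i u, s) \<in> rG" "(s, \<one>\<^bsub>G\<^esub>) \<in> rG\<^sup>="
      using G.ceiling_decomp[OF g(1)] by blast
    then have "(inv\<^bsub>X\<^esub> inG (i u), inG s) \<in> R" "(inG s, \<one>\<^bsub>X\<^esub>) \<in> R\<^sup>="
      using exG[OF as(4)] exG[of s "\<one>\<^bsub>G\<^esub>"] by (auto simp: inG_inv inG_one)
    moreover have "x = inG (i a) \<otimes>\<^bsub>X\<^esub> inG s" using as g by (simp add: inG_mult)
    ultimately show ?thesis using as by blast
  qed
  have H_decomp: "\<exists>a\<in>inG ` i ` carrier A. \<exists>t\<in>inH ` carrier H. x = a \<otimes>\<^bsub>X\<^esub> t \<and>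
      (\<one>\<^bsub>X\<^esub>, t) \<in> R\<^sup>= \<and> (t, inG (i u)) \<in> R" if x: "x \<in> inH ` carrier H" for x
  proof -
    obtain h where h: "h \<in> carrier H" "x = inH h" using x by blast
    obtain a t where at: "a \<in> carrier A" "t \<in> carrier H" "h = j a \<otimes>\<^bsub>H\<^esub> t"
        "(\<one>\<^bsub>H\<^esub>, t) \<in> rH\<^sup>=" "(t, j u) \<in> rH"
      using H.floor_decomp[OF h(1)] by blast
    then have "(\<one>\<^bsub>X\<^esub>, inH t) \<in> R\<^sup>=" "(inH t, inG (i u)) \<in> R"
      using exH[OF at(5)] exH[of "\<one>\<^bsub>H\<^esub>" t] by (auto simp: inH_one inG_i)
    moreover have "x = inG (i a) \<otimes>\<^bsub>X\<^esub> inH t" using at h by (simp add: inH_mult inG_i)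
    ultimately show ?thesis using at by blast
  qed
  have generated': "carrier X \<subseteq> Y" if "\<one>\<^bsub>X\<^esub> \<in> Y"
      "\<And>g y. g \<in> inG ` carrier G \<Longrightarrow> y \<in> carrier X \<Longrightarrow> y \<in> Y \<Longrightarrow> g \<otimes>\<^bsub>X\<^esub> y \<in> Y"
      "\<And>h y. h \<in> inH ` carrier H \<Longrightarrow> y \<in> carrier X \<Longrightarrow> y \<in> Y \<Longrightarrow> h \<otimes>\<^bsub>X\<^esub> y \<in> Y" for Y
    using that by (intro generated) auto
  have sub: "inG ` i ` carrier A \<subseteq> inG ` carrier G" "inG ` i ` carrier A \<subseteq> inH ` carrier H"
    by (auto simp: inG_i)
  show ?thesis
    by (rule amalgam_order.intro[OF assms(1) A G H], rule amalgam_order_axioms.intro)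
      (fact sub G_decomp H_decomp assms(3) generated')+
qed

end

section \<open>Existence, uniqueness and properties of the order\<close>

context amalgam begin

text \<open>For uniqueness, \<open>R \<inter> R'\<close> again extends both orders and makes
  \<open>z\<close> positive, so it is total. A total strict order is not properly contained in a
  strict order, hence it equals both.\<close>

lemma ex_unique_amalgam_order:
  "\<exists>R\<in>LO X. rG \<subseteq> inv_image R inG \<and> rH \<subseteq> inv_image R inH \<and>
    (\<forall>R'\<in>LO X. rG \<subseteq> inv_image R' inG \<longrightarrow> rH \<subseteq> inv_image R' inH \<longrightarrow> (\<one>\<^bsub>X\<^esub>, z) \<in> R' \<longrightarrow> R' = R) \<and>
    is_min_positive X R z \<and> stepping X R (inG ` i ` carrier A)"
proof -
  obtain R where R: "partial_left_order X R" "extends R" "(\<one>\<^bsub>X\<^esub>, z) \<in> R"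
    using ex_extending_order by blast
  interpret R: amalgam_order X R "inG ` i ` carrier A" "inG (i u)" "inG ` carrier G" "inG p"
      "inH ` carrier H" "inH q"
    using R by (rule order_of_extends)
  have "R \<in> LO X"
    using R.R_subset R.R_trans R.R_irrefl R.total R.R_mult
    by (auto simp: LO_def strict_linear_order_on_def)
  moreover have "R' = R" if R': "R' \<in> LO X" "rG \<subseteq> inv_image R' inG" "rH \<subseteq> inv_image R' inH"
      "(\<one>\<^bsub>X\<^esub>, z) \<in> R'" for R'
  proof -
    interpret R': partial_left_order X R'
      using X.is_group R'(1) by (rule LO_partial_left_order)
    have "partial_left_order X (R \<inter> R')"
      using R.R_subset R.R_trans R'.R_trans R.R_irrefl R.R_mult R'.R_mult
      by unfold_locales (auto simp: irrefl_def intro: trans_Int)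
    moreover have "extends (R \<inter> R')"
      using R(2) R'(2,3) unfolding inv_image_def by blast
    moreover have "(\<one>\<^bsub>X\<^esub>, z) \<in> R \<inter> R'" using R(3) R' by simp
    ultimately have "amalgam_order X (R \<inter> R') (inG ` i ` carrier A) (inG (i u))
        (inG ` carrier G) (inG p) (inH ` carrier H) (inH q)"
      by (rule order_of_extends)
    then interpret RR': amalgam_order X "R \<inter> R'" "inG ` i ` carrier A" "inG (i u)"
        "inG ` carrier G" "inG p" "inH ` carrier H" "inH q" .
    have either: "(x, y) \<in> R \<inter> R' \<or> (y, x) \<in> R \<inter> R'"
      if "x \<in> carrier X" "y \<in> carrier X" "x \<noteq> y" for x y
      using RR'.total that unfolding total_on_def by blast
    show ?thesis
    proof (intro equalityI subrelI)
      fix x y assume xy: "(x, y) \<in> R'"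
      then have "(y, x) \<notin> R'" "x \<noteq> y" using R'.lt_irrefl R'.lt_trans by blast+
      then show "(x, y) \<in> R" using either[of x y] R'.lt_closed[OF xy] by blast
    next
      fix x y assume xy: "(x, y) \<in> R"
      then have "(y, x) \<notin> R" "x \<noteq> y" using R.lt_irrefl R.lt_trans by blast+
      then show "(x, y) \<in> R'" using either[of x y] R.lt_closed[OF xy] by blast
    qed
  qed
  moreover have "is_min_positive X R z"
    using R.min_positive R.z_pos by (simp add: is_min_positive_def)
  moreover have "stepping X R (inG ` i ` carrier A)"
    unfolding stepping_def
  proof (intro conjI ballI R.A.S_subgroup)
    fix x assume "x \<in> carrier X"
    \<comment> \<open>The floor \<open>a\<close> is the required maximum, and its successor
      \<open>a u\<close> the required minimum.\<close>
    then obtain a where a: "a \<in> inG ` i ` carrier A" "(a, x) \<in> R\<^sup>="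
        "(x, a \<otimes>\<^bsub>X\<^esub> inG (i u)) \<in> R"
      using R.A_floor by blast
    have succ: "(a \<otimes>\<^bsub>X\<^esub> inG (i u), b) \<in> R\<^sup>=" if "b \<in> inG ` i ` carrier A" "(a, b) \<in> R" for b
      using R.A.succ_le[OF a(1) that] .
    have "(b, a) \<in> R\<^sup>=" if b: "b \<in> inG ` i ` carrier A" "(b, x) \<in> R\<^sup>=" for b
    proof (rule R.A.not_lt[OF a(1) b(1)])
      show "(a, b) \<notin> R"
        using succ[OF b(1)] a(3) b(2) R.le_trans R.le_not_lt by blast
    qed
    with a show "\<exists>m\<in>inG ` i ` carrier A. (m, x) \<in> R\<^sup>= \<and>
        (\<forall>b\<in>inG ` i ` carrier A. (b, x) \<in> R\<^sup>= \<longrightarrow> (b, m) \<in> R\<^sup>=)" by blast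
    have "a \<otimes>\<^bsub>X\<^esub> inG (i u) \<in> inG ` i ` carrier A"
      using R.A.mult_mem[OF a(1) R.A.m_mem] .
    moreover have "(a \<otimes>\<^bsub>X\<^esub> inG (i u), b) \<in> R\<^sup>="
      if b: "b \<in> inG ` i ` carrier A" "(x, b) \<in> R" for b
      using succ[OF b(1)] R.le_lt_trans[OF a(2) b(2)] .
    ultimately show "\<exists>m\<in>inG ` i ` carrier A. (x, m) \<in> R \<and>
        (\<forall>b\<in>inG ` i ` carrier A. (x, b) \<in> R \<longrightarrow> (m, b) \<in> R\<^sup>=)"
      using a(3) by blast
  qed
  ultimately show ?thesis using R(2) by blast
qed

end

section \<open>Characteristic positive sets\<close>

text \<open>Finite intersections of sub-basic sets form a basis; the induction follows the
  generation of the topology.\<close>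

lemma openin_LO_topology_finite:
  assumes "openin (LO_topology G) U" "r \<in> U"
  shows "\<exists>P. finite P \<and> P \<subseteq> carrier G \<and> r \<in> LO G \<inter> (\<Inter>g\<in>P. LO_pos G g) \<and>
    LO G \<inter> (\<Inter>g\<in>P. LO_pos G g) \<subseteq> U"
proof -
  have "generate_topology_on (insert (LO G) (LO_pos G ` carrier G)) U"
    using assms(1) by (simp add: LO_topology_def openin_topology_generated_by_iff)
  then show ?thesis using assms(2)
  proof (induction rule: generate_topology_on.induct)
    case (Int a b)
    from Int.IH(1) Int.prems obtain P where P: "finite P" "P \<subseteq> carrier G"
        "r \<in> LO G \<inter> (\<Inter>g\<in>P. LO_pos G g)" "LO G \<inter> (\<Inter>g\<in>P. LO_pos G g) \<subseteq> a"
      by blast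
    from Int.IH(2) Int.prems obtain Q where Q: "finite Q" "Q \<subseteq> carrier G"
        "r \<in> LO G \<inter> (\<Inter>g\<in>Q. LO_pos G g)" "LO G \<inter> (\<Inter>g\<in>Q. LO_pos G g) \<subseteq> b"
      by blast
    have "LO G \<inter> (\<Inter>g\<in>P \<union> Q. LO_pos G g) =
        (LO G \<inter> (\<Inter>g\<in>P. LO_pos G g)) \<inter> (LO G \<inter> (\<Inter>g\<in>Q. LO_pos G g))"
      by auto
    then show ?case
      using P Q by (metis IntI Int_mono Un_subset_iff finite_UnI)
  next
    case (UN K)
    then show ?case by (meson Sup_upper UnionE subset_trans)
  next
    case (Basis s)
    then consider "s = LO G" | g where "g \<in> carrier G" "s = LO_pos G g" by blast
    then show ?case
    proof cases
      case 1
      \<comment> \<open>The generator \<open>LO G\<close> corresponds to imposing no positivity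
        condition.\<close>
      then show ?thesis using Basis by (intro exI[of _ "{}"]) auto
    next
      case 2
      then show ?thesis using Basis by (intro exI[of _ "{g}"]) (auto simp: LO_pos_def)
    qed
  qed simp
qed

lemma isolated_ordering_iff:
  "isolated_ordering G r \<longleftrightarrow> (\<exists>P. characteristic_positive_set G r P)"
proof
  assume "isolated_ordering G r"
  then obtain P where P: "finite P" "P \<subseteq> carrier G" "r \<in> LO G \<inter> (\<Inter>g\<in>P. LO_pos G g)"
      "LO G \<inter> (\<Inter>g\<in>P. LO_pos G g) \<subseteq> {r}"
    using openin_LO_topology_finite[of G "{r}" r] unfolding isolated_ordering_def by blast
  have "LO G \<inter> (\<Inter>g\<in>P. LO_pos G g) = {r}"
    by (rule equalityI[OF P(4)]) (use P(3) in simp)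
  then show "\<exists>P. characteristic_positive_set G r P"
    using P(1,2) unfolding characteristic_positive_set_def by blast
next
  assume "\<exists>P. characteristic_positive_set G r P"
  then obtain P where P: "finite P" "P \<subseteq> carrier G" "LO G \<inter> (\<Inter>g\<in>P. LO_pos G g) = {r}"
    by (auto simp: characteristic_positive_set_def)
  have "openin (LO_topology G) ((\<Inter>g\<in>P. LO_pos G g) \<inter> topspace (LO_topology G))"
    using P(1,2) by (intro openin_INT) (auto simp: LO_topology_def topology_generated_by_Basis)
  then show "isolated_ordering G r"
    using P(3) by (simp add: isolated_ordering_def topspace_LO_topology Int_commute)
qed

lemma relatively_isolated_ordering_imp:
  assumes "relatively_isolated_ordering G B r"
  shows "\<exists>P. relative_characteristic_positive_set G B r P"
proof -
  obtain U where U: "openin (LO_topology G) U" "{r} = U \<inter> Res_fibre G B r"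
    using assms by (auto simp: relatively_isolated_ordering_def openin_subtopology)
  then obtain P where "finite P" "P \<subseteq> carrier G" "r \<in> LO G \<inter> (\<Inter>g\<in>P. LO_pos G g)"
      "LO G \<inter> (\<Inter>g\<in>P. LO_pos G g) \<subseteq> U"
    using openin_LO_topology_finite[of G U r] by blast
  moreover have "F \<inter> N = {r}" if "{r} = U \<inter> F" "F \<subseteq> L" "L \<inter> N \<subseteq> U" "r \<in> L \<inter> N" for F L N
    using that by blast
  moreover have "Res_fibre G B r \<subseteq> LO G" by (auto simp: Res_fibre_def)
  ultimately show ?thesis
    using U(2) unfolding relative_characteristic_positive_set_def by metis
qed

text \<open>Injectivity of \<open>f\<close> carries totality back to \<open>G\<close>. The
  restriction keeps the relation inside the carrier, as \<open>LO\<close> demands.\<close>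

lemma pullback_LO:
  assumes "group G" "group X" "f \<in> hom G X" "inj_on f (carrier G)" "R \<in> LO X"
  shows "Restr (inv_image R f) (carrier G) \<in> LO G"
proof -
  interpret G: group G by fact
  interpret R: partial_left_order X R using assms by (intro LO_partial_left_order)
  have tot: "total_on (carrier X) R" using assms(5) by (simp add: LO_def strict_linear_order_on_def)
  have closed: "f x \<in> carrier X" if "x \<in> carrier G" for x using assms(3) that by (auto simp: hom_def)
  have "trans (Restr (inv_image R f) (carrier G))"
    by (rule transI) (auto intro: R.lt_trans)
  moreover have "irrefl (Restr (inv_image R f) (carrier G))"
    by (rule irreflI) (auto simp: R.lt_irrefl)
  moreover have "total_on (carrier G) (Restr (inv_image R f) (carrier G))"
  proof (rule total_onI)
    fix x y assume xy: "x \<in> carrier G" "y \<in> carrier G" "x \<noteq> y"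
    then have "f x \<noteq> f y" using assms(4) by (auto dest: inj_onD)
    then show "(x, y) \<in> Restr (inv_image R f) (carrier G) \<or>
        (y, x) \<in> Restr (inv_image R f) (carrier G)"
      using tot closed xy unfolding total_on_def by auto
  qed
  ultimately show ?thesis
    using assms(3) R.R_mult by (auto simp: LO_def strict_linear_order_on_def hom_def)
qed

lemma (in partial_left_order) min_positive_eq:
  assumes "is_min_positive X R p"
  shows "min_positive X R = p"
  unfolding min_positive_def
proof (rule the_equality)
  show "is_min_positive X R p" by fact
  fix p' assume "is_min_positive X R p'"
  with assms have "p \<preceq> p'" "p' \<preceq> p" by (auto simp: is_min_positive_def)
  then show "p' = p" using le_not_lt by blast
qed

text \<open>The stepping property at 1 yields the minimal positive element \<open>u\<close> of
  \<open>A\<close>. For general \<open>g\<close>, maximality of the largest \<open>i a\<close> below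
  \<open>g\<close> excludes \<open>i (a u) \<le> g\<close>, and totality then gives the floor
  property.\<close>

lemma stepping_imp_stepped_extension:
  assumes "group A" "group G" "i \<in> mon A G" "r \<in> LO G" "stepping G r (i ` carrier A)"
    and rA: "Restr (inv_image r i) (carrier A) = rA"
  shows "stepped_extension A rA G r i (min_positive A rA)"
proof -
  have i: "i \<in> hom A G" "inj_on i (carrier A)" using assms(3) by (auto simp: mon_def)
  interpret G: partial_left_order G r using assms(2,4) by (rule LO_partial_left_order)
  have "rA \<in> LO A" using pullback_LO[OF assms(1,2) i assms(4)] rA by simp
  then interpret A: partial_left_order A rA using assms(1) by (intro LO_partial_left_order)
  interpret i: group_hom A G i
    using assms(1,2) i(1) by (simp add: group_hom_def group_hom_axioms_def)
  have total: "total_on (carrier A) rA" "total_on (carrier G) r"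
    using \<open>rA \<in> LO A\<close> assms(4) by (auto simp: LO_def strict_linear_order_on_def)
  have iff: "(a, b) \<in> rA \<longleftrightarrow> (i a, i b) \<in> r" if "a \<in> carrier A" "b \<in> carrier A" for a b
    using that rA by auto
  obtain m where m: "m \<in> i ` carrier A" "(\<one>\<^bsub>G\<^esub>, m) \<in> r"
      "\<And>b. b \<in> i ` carrier A \<Longrightarrow> (\<one>\<^bsub>G\<^esub>, b) \<in> r \<Longrightarrow> (m, b) \<in> r\<^sup>="
    using assms(5) unfolding stepping_def by (meson G.one_closed)
  then obtain u where u: "u \<in> carrier A" "m = i u" by blast
  have u_min: "is_min_positive A rA u"
    unfolding is_min_positive_def
  proof (intro conjI allI impI)
    show "(\<one>\<^bsub>A\<^esub>, u) \<in> rA" using m u by (simp add: iff)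
    fix a assume a: "(\<one>\<^bsub>A\<^esub>, a) \<in> rA"
    then have aA: "a \<in> carrier A" using A.lt_closed by blast
    then have "(\<one>\<^bsub>G\<^esub>, i a) \<in> r" using a iff[of "\<one>\<^bsub>A\<^esub>" a] by simp
    then have "(i u, i a) \<in> r\<^sup>=" using m(3)[OF imageI[OF aA]] u(2) by simp
    then show "(u, a) \<in> rA\<^sup>=" using iff u aA i(2) by (auto simp: inj_on_def)
  qed
  show ?thesis
    unfolding A.min_positive_eq[OF u_min]
  proof unfold_locales
    fix g assume g: "g \<in> carrier G"
    then obtain m' where "m' \<in> i ` carrier A" "(m', g) \<in> r\<^sup>="
        "\<forall>b\<in>i ` carrier A. (b, g) \<in> r\<^sup>= \<longrightarrow> (b, m') \<in> r\<^sup>="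
      using assms(5) unfolding stepping_def by blast
    then obtain a where a: "a \<in> carrier A" "(i a, g) \<in> r\<^sup>="
        "\<And>b. b \<in> carrier A \<Longrightarrow> (i b, g) \<in> r\<^sup>= \<Longrightarrow> (i b, i a) \<in> r\<^sup>="
      by blast
    have "(i a, i (a \<otimes>\<^bsub>A\<^esub> u)) \<in> r" using a u m(2) by (simp add: G.lt_mult_right)
    then have "(i (a \<otimes>\<^bsub>A\<^esub> u), g) \<notin> r\<^sup>="
      using a(3)[of "a \<otimes>\<^bsub>A\<^esub> u"] a(1) u(1) G.le_not_lt by auto
    then have "(g, i (a \<otimes>\<^bsub>A\<^esub> u)) \<in> r"
      using total(2) g a(1) u(1) by (auto simp: total_on_def)
    with a show "\<exists>a\<in>carrier A. (i a, g) \<in> r\<^sup>= \<and> (g, i (a \<otimes>\<^bsub>A\<^esub> u)) \<in> r" by blast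
  qed (use total i(1) u_min rA in auto)
qed

text \<open>Let \<open>R'\<close> make the whole set positive. Its pullback to \<open>G\<close> must
  be \<open>rG\<close>; this fixes the order on \<open>A\<close>, so the pullback to
  \<open>H\<close> lies in the fibre of \<open>rH\<close> and must be \<open>rH\<close>. Then
  \<open>unique\<close> applies. As \<open>z\<close> is arbitrary, the lemma serves both
  orders.\<close>

lemma amalgam_characteristic_set:
  assumes "group A" "group G" "group H" "group X" "inG \<in> hom G X" "inH \<in> hom H X"
    and i: "\<And>a. a \<in> carrier A \<Longrightarrow> i a \<in> carrier G" and j: "\<And>a. a \<in> carrier A \<Longrightarrow> j a \<in> carrier H"
    and inG_i: "\<And>a. a \<in> carrier A \<Longrightarrow> inG (i a) = inH (j a)"
    and rG: "rG \<in> LO G" and rH: "rH \<in> LO H"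
    and rA: "Restr (inv_image rG i) (carrier A) = Restr (inv_image rH j) (carrier A)"
    and R: "R \<in> LO X" "rG \<subseteq> inv_image R inG" "rH \<subseteq> inv_image R inH" "(\<one>\<^bsub>X\<^esub>, z) \<in> R"
    and unique: "\<And>R'. R' \<in> LO X \<Longrightarrow> rG \<subseteq> inv_image R' inG \<Longrightarrow> rH \<subseteq> inv_image R' inH \<Longrightarrow>
      (\<one>\<^bsub>X\<^esub>, z) \<in> R' \<Longrightarrow> R' = R"
    and P: "characteristic_positive_set G rG P"
    and Q: "relative_characteristic_positive_set H (j ` carrier A) rH Q"
  shows "characteristic_positive_set X R (inG ` P \<union> inH ` Q \<union> {z})"
proof -
  interpret R: partial_left_order X R using assms(4) R(1) by (rule LO_partial_left_order)
  have tot: "total_on (carrier G) rG" "total_on (carrier H) rH"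
    using rG rH by (auto simp: LO_def strict_linear_order_on_def)
  \<comment> \<open>The factors embed because distinct elements are comparable and \<open>R\<close>
    keeps comparable elements apart.\<close>
  have inj: "inj_on inG (carrier G)" "inj_on inH (carrier H)"
    using tot R.lt_irrefl R(2,3) unfolding total_on_def inj_on_def by (metis in_inv_image subsetD)+
  have one: "inG \<one>\<^bsub>G\<^esub> = \<one>\<^bsub>X\<^esub>" "inH \<one>\<^bsub>H\<^esub> = \<one>\<^bsub>X\<^esub>"
    using hom_one[OF assms(5,2,4)] hom_one[OF assms(6,3,4)] .
  have PQ: "finite P" "P \<subseteq> carrier G" "finite Q" "Q \<subseteq> carrier H"
      and P_eq: "LO G \<inter> (\<Inter>g\<in>P. LO_pos G g) = {rG}"
      and Q_eq: "Res_fibre H (j ` carrier A) rH \<inter> (\<Inter>h\<in>Q. LO_pos H h) = {rH}"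
    using P Q
    by (simp_all add: characteristic_positive_set_def relative_characteristic_positive_set_def)
  have "rG \<in> LO G \<inter> (\<Inter>g\<in>P. LO_pos G g)" by (simp only: P_eq insertI1)
  then have P_pos: "\<forall>g\<in>P. (\<one>\<^bsub>G\<^esub>, g) \<in> rG" by (simp add: LO_pos_def)
  have "rH \<in> Res_fibre H (j ` carrier A) rH \<inter> (\<Inter>h\<in>Q. LO_pos H h)"
    by (simp only: Q_eq insertI1)
  then have Q_pos: "\<forall>h\<in>Q. (\<one>\<^bsub>H\<^esub>, h) \<in> rH" by (simp add: LO_pos_def)
  let ?S = "inG ` P \<union> inH ` Q \<union> {z}"
  have S: "finite ?S" "?S \<subseteq> carrier X"
    using PQ R.lt_closed[OF R(4)] assms(5,6) by (auto simp: hom_def)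
  have R_pos: "R \<in> LO_pos X x" if x: "x \<in> ?S" for x
  proof -
    consider g where "g \<in> P" "x = inG g" | h where "h \<in> Q" "x = inH h" | "x = z"
      using x by blast
    then have "(\<one>\<^bsub>X\<^esub>, x) \<in> R"
    proof cases
      case (1 g)
      then show ?thesis using P_pos subsetD[OF R(2), of "(\<one>\<^bsub>G\<^esub>, g)"] one by simp
    next
      case (2 h)
      then show ?thesis using Q_pos subsetD[OF R(3), of "(\<one>\<^bsub>H\<^esub>, h)"] one by simp
    qed (use R(4) in simp)
    then show ?thesis using R(1) by (simp add: LO_pos_def)
  qed
  have eq: "R' = R"
    if R': "R' \<in> LO X" and pos: "\<And>x. x \<in> ?S \<Longrightarrow> R' \<in> LO_pos X x" for R'
  proof -
    let ?rG = "Restr (inv_image R' inG) (carrier G)"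
    let ?rH = "Restr (inv_image R' inH) (carrier H)"
    have G_LO: "?rG \<in> LO G" and H_LO: "?rH \<in> LO H"
      using assms(2-6) inj R' by (auto intro!: pullback_LO)
    have "?rG \<in> LO G \<inter> (\<Inter>g\<in>P. LO_pos G g)"
      using G_LO pos PQ one assms(2) by (auto simp: LO_pos_def group.is_monoid)
    then have rG_eq: "?rG = rG" unfolding P_eq by simp
    have "(j a, j b) \<in> ?rH \<longleftrightarrow> (j a, j b) \<in> rH" if ab: "a \<in> carrier A" "b \<in> carrier A" for a b
    proof -
      have "(j a, j b) \<in> ?rH \<longleftrightarrow> (i a, i b) \<in> ?rG" using ab i j inG_i by simp
      also have "\<dots> \<longleftrightarrow> (a, b) \<in> Restr (inv_image rG i) (carrier A)" unfolding rG_eq using ab by simp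
      also have "\<dots> \<longleftrightarrow> (j a, j b) \<in> rH" unfolding rA using ab by simp
      finally show ?thesis .
    qed
    then have "Restr ?rH (j ` carrier A) = Restr rH (j ` carrier A)" by blast
    then have "?rH \<in> Res_fibre H (j ` carrier A) rH \<inter> (\<Inter>h\<in>Q. LO_pos H h)"
      using H_LO pos PQ one assms(3) by (auto simp: Res_fibre_def LO_pos_def group.is_monoid)
    then have "?rH = rH" unfolding Q_eq by simp
    with rG_eq show ?thesis
      using R' pos[of z] by (intro unique) (auto simp: LO_pos_def)
  qed
  have "LO X \<inter> (\<Inter>x\<in>?S. LO_pos X x) = {R}"
  proof (rule Set.set_eqI)
    fix R'
    have "R' \<in> LO X \<inter> (\<Inter>x\<in>?S. LO_pos X x) \<longleftrightarrow> R' \<in> LO X \<and> (\<forall>x\<in>?S. R' \<in> LO_pos X x)"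
      by (simp only: Int_iff INT_iff)
    then show "R' \<in> LO X \<inter> (\<Inter>x\<in>?S. LO_pos X x) \<longleftrightarrow> R' \<in> {R}"
      using eq[of R'] R(1) R_pos by (metis singleton_iff)
  qed
  with S show ?thesis unfolding characteristic_positive_set_def by simp
qed

text \<open>Induction on a representing word, since prepending a letter is left multiplication by
  its class.\<close>

lemma amalg_product_generated:
  assumes "group G" "group H" "i \<in> hom A G" "j \<in> hom A H"
    and one: "\<one>\<^bsub>amalg_product A G H i j\<^esub> \<in> Y"
    and inl: "\<And>g y. g \<in> carrier G \<Longrightarrow> y \<in> carrier (amalg_product A G H i j) \<Longrightarrow> y \<in> Y \<Longrightarrow>
      amalg_inl A G H i j g \<otimes>\<^bsub>amalg_product A G H i j\<^esub> y \<in> Y"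
    and inr: "\<And>h y. h \<in> carrier H \<Longrightarrow> y \<in> carrier (amalg_product A G H i j) \<Longrightarrow> y \<in> Y \<Longrightarrow>
      amalg_inr A G H i j h \<otimes>\<^bsub>amalg_product A G H i j\<^esub> y \<in> Y"
  shows "carrier (amalg_product A G H i j) \<subseteq> Y"
proof
  note amalg = assms(1-4)
  fix x assume "x \<in> carrier (amalg_product A G H i j)"
  then obtain w where w: "w \<in> amalg_words G H" "x = amalg_class A G H i j w"
    using amalg_product_cases[OF amalg] by metis
  have "amalg_class A G H i j w \<in> Y" using w(1)
  proof (induction w)
    case Nil
    show ?case using one by (simp add: amalg_product_one[OF amalg])
  next
    case (Cons l w)
    then have lw: "[l] \<in> amalg_words G H" "w \<in> amalg_words G H" by auto
    have "amalg_class A G H i j (l # w) =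
        amalg_class A G H i j [l] \<otimes>\<^bsub>amalg_product A G H i j\<^esub> amalg_class A G H i j w"
      using amalg_product_mult[OF amalg lw] by simp
    then show ?case
      using Cons lw inl inr amalg_class_closed[OF amalg lw(2)]
      by (cases l) (auto simp: amalg_inl_def amalg_inr_def)
  qed
  with w show "x \<in> Y" by simp
qed

section \<open>The two isolated orders on the amalgamated free product\<close>

theorem theorem1p3:
  fixes A :: "('a, 'l) monoid_scheme" and G :: "('g, 'm) monoid_scheme"
    and H :: "('h, 'n) monoid_scheme"
    and i :: "'a \<Rightarrow> 'g" and j :: "'a \<Rightarrow> 'h"
    and rA :: "'a rel" and rG :: "'g rel" and rH :: "'h rel"
    and a\<^sub>m\<^sub>i\<^sub>n :: 'a and g\<^sub>m\<^sub>i\<^sub>n :: 'g and h\<^sub>m\<^sub>i\<^sub>n :: 'h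
    and X :: "('g + 'h) list set monoid"
    and inG :: "'g \<Rightarrow> ('g + 'h) list set" and inH :: "'h \<Rightarrow> ('g + 'h) list set"
  assumes "left_orderable A" and "left_orderable G" and "left_orderable H"
    and "i \<in> mon A G" and "j \<in> mon A H"
    and "rG \<in> LO G" and "discrete_ordering G rG"
    and "rH \<in> LO H" and "discrete_ordering H rH"
    and "Restr (inv_image rG i) (carrier A) = rA"
    and "Restr (inv_image rH j) (carrier A) = rA"
    and "stepping G rG (i ` carrier A)" and "stepping H rH (j ` carrier A)"
    and "isolated_ordering G rG"
    and "relatively_isolated_ordering H (j ` carrier A) rH"
    and "a\<^sub>m\<^sub>i\<^sub>n = min_positive A rA"
    and "g\<^sub>m\<^sub>i\<^sub>n = min_positive G rG"
    and "h\<^sub>m\<^sub>i\<^sub>n = min_positive H rH"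
    and "X = amalg_product A G H i j"
    and "inG = amalg_inl A G H i j"
    and "inH = amalg_inr A G H i j"
  shows "\<exists>r\<^sub>1\<in>LO X. \<exists>r\<^sub>2\<in>LO X.
     isolated_ordering X r\<^sub>1 \<and> isolated_ordering X r\<^sub>2 \<and>
     (\<forall>g g'. (g, g') \<in> rG \<longrightarrow> (inG g, inG g') \<in> r\<^sub>1 \<and> (inG g, inG g') \<in> r\<^sub>2) \<and>
     (\<forall>h h'. (h, h') \<in> rH \<longrightarrow> (inH h, inH h') \<in> r\<^sub>1 \<and> (inH h, inH h') \<in> r\<^sub>2) \<and>
     (\<forall>P Q. characteristic_positive_set G rG P \<longrightarrow>
        relative_characteristic_positive_set H (j ` carrier A) rH Q \<longrightarrow>
        characteristic_positive_set X r\<^sub>1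
          (inG ` P \<union> inH ` Q \<union>
           {inH h\<^sub>m\<^sub>i\<^sub>n \<otimes>\<^bsub>X\<^esub> inv\<^bsub>X\<^esub> (inG (i a\<^sub>m\<^sub>i\<^sub>n)) \<otimes>\<^bsub>X\<^esub> inG g\<^sub>m\<^sub>i\<^sub>n}) \<and>
        characteristic_positive_set X r\<^sub>2
          (inG ` P \<union> inH ` Q \<union>
           {inG g\<^sub>m\<^sub>i\<^sub>n \<otimes>\<^bsub>X\<^esub> inv\<^bsub>X\<^esub> (inG (i a\<^sub>m\<^sub>i\<^sub>n)) \<otimes>\<^bsub>X\<^esub> inH h\<^sub>m\<^sub>i\<^sub>n})) \<and>
     is_min_positive X r\<^sub>1 (inH h\<^sub>m\<^sub>i\<^sub>n \<otimes>\<^bsub>X\<^esub> inv\<^bsub>X\<^esub> (inG (i a\<^sub>m\<^sub>i\<^sub>n)) \<otimes>\<^bsub>X\<^esub> inG g\<^sub>m\<^sub>i\<^sub>n) \<and>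
     is_min_positive X r\<^sub>2 (inG g\<^sub>m\<^sub>i\<^sub>n \<otimes>\<^bsub>X\<^esub> inv\<^bsub>X\<^esub> (inG (i a\<^sub>m\<^sub>i\<^sub>n)) \<otimes>\<^bsub>X\<^esub> inH h\<^sub>m\<^sub>i\<^sub>n) \<and>
     stepping X r\<^sub>1 (inG ` i ` carrier A) \<and> stepping X r\<^sub>2 (inG ` i ` carrier A)"
proof -
  have grp: "group A" "group G" "group H"
    using assms(1-3) by (auto simp: left_orderable_def)
  have hom: "i \<in> hom A G" "j \<in> hom A H" using assms(4,5) by (auto simp: mon_def)
  note am = grp(2,3) hom
  have X: "group X" and inG: "inG \<in> hom G X" and inH: "inH \<in> hom H X"
    and inG_i: "\<And>a. a \<in> carrier A \<Longrightarrow> inG (i a) = inH (j a)"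
    unfolding \<open>X = _\<close> \<open>inG = _\<close> \<open>inH = _\<close>
    using group_amalg_product[OF am] amalg_inl_hom[OF am] amalg_inr_hom[OF am]
      amalg_inl_eq_inr[OF am] by blast+
  let ?u = "a\<^sub>m\<^sub>i\<^sub>n"
  have extG: "stepped_extension A rA G rG i ?u"
    using stepping_imp_stepped_extension[OF grp(1,2) assms(4,6,12,10)] assms(16) by simp
  have extH: "stepped_extension A rA H rH j ?u"
    using stepping_imp_stepped_extension[OF grp(1,3) assms(5,8,13,11)] assms(16) by simp
  interpret A: partial_left_order A rA using extG by (simp add: stepped_extension_def)
  interpret G: partial_left_order G rG using grp(2) assms(6) by (rule LO_partial_left_order)
  interpret H: partial_left_order H rH using grp(3) assms(8) by (rule LO_partial_left_order)
  have g_min: "is_min_positive G rG g\<^sub>m\<^sub>i\<^sub>n" and h_min: "is_min_positive H rH h\<^sub>m\<^sub>i\<^sub>n"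
    using assms(7,9,17,18) G.min_positive_eq H.min_positive_eq
    by (auto simp: discrete_ordering_def)
  have u: "?u \<in> carrier A" using stepped_extension.u_closed[OF extG] .
  have generated: "carrier X \<subseteq> Y"
    if "\<one>\<^bsub>X\<^esub> \<in> Y"
      "\<And>g y. g \<in> carrier G \<Longrightarrow> y \<in> carrier X \<Longrightarrow> y \<in> Y \<Longrightarrow> inG g \<otimes>\<^bsub>X\<^esub> y \<in> Y"
      "\<And>h y. h \<in> carrier H \<Longrightarrow> y \<in> carrier X \<Longrightarrow> y \<in> Y \<Longrightarrow> inH h \<otimes>\<^bsub>X\<^esub> y \<in> Y" for Y
    using amalg_product_generated[OF am, of Y] that assms(19-21) by blast
  note universal = amalg_product_universal[OF am, folded assms(19-21)]
  have amalgGH: "amalgam A rA G rG i ?u H rH j X inG inH g\<^sub>m\<^sub>i\<^sub>n h\<^sub>m\<^sub>i\<^sub>n"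
    by (intro amalgam.intro amalgam_axioms.intro extG extH X inG inH inG_i g_min h_min)
      (assumption | fact generated universal)+
  \<comment> \<open>The same group \<open>X\<close> with its inclusions exchanged; the distinguished
    element becomes \<open>?z2\<close>.\<close>
  have amalgHG: "amalgam A rA H rH j ?u G rG i X inH inG h\<^sub>m\<^sub>i\<^sub>n g\<^sub>m\<^sub>i\<^sub>n"
  proof (intro amalgam.intro amalgam_axioms.intro extG extH X inG inH g_min h_min)
    fix K :: "('a \<times> ('h + 'g) list \<Rightarrow> 'a \<times> ('h + 'g) list) monoid" and f k
    assume "group K" "f \<in> hom H K" "k \<in> hom G K" "\<And>a. a \<in> carrier A \<Longrightarrow> f (j a) = k (i a)"
    then show "\<exists>\<phi>\<in>hom X K. (\<forall>g\<in>carrier H. \<phi> (inH g) = f g) \<and> (\<forall>h\<in>carrier G. \<phi> (inG h) = k h)"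
      using universal[of K k f] by auto
  qed (use inG_i generated in auto)
  let ?z1 = "inH h\<^sub>m\<^sub>i\<^sub>n \<otimes>\<^bsub>X\<^esub> inv\<^bsub>X\<^esub> (inG (i ?u)) \<otimes>\<^bsub>X\<^esub> inG g\<^sub>m\<^sub>i\<^sub>n"
  let ?z2 = "inG g\<^sub>m\<^sub>i\<^sub>n \<otimes>\<^bsub>X\<^esub> inv\<^bsub>X\<^esub> (inG (i ?u)) \<otimes>\<^bsub>X\<^esub> inH h\<^sub>m\<^sub>i\<^sub>n"
  obtain r1 where r1: "r1 \<in> LO X" "rG \<subseteq> inv_image r1 inG" "rH \<subseteq> inv_image r1 inH"
      "is_min_positive X r1 ?z1" "stepping X r1 (inG ` i ` carrier A)"
    and unique1: "\<And>R'. R' \<in> LO X \<Longrightarrow> rG \<subseteq> inv_image R' inG \<Longrightarrow> rH \<subseteq> inv_image R' inH \<Longrightarrow>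
      (\<one>\<^bsub>X\<^esub>, ?z1) \<in> R' \<Longrightarrow> R' = r1"
    using amalgam.ex_unique_amalgam_order[OF amalgGH] by metis
  \<comment> \<open>The exchanged instance reaches \<open>A\<close> through \<open>H\<close>; both
    routes give the same elements of \<open>X\<close>.\<close>
  have swap: "inH (j ?u) = inG (i ?u)" "inH ` j ` carrier A = inG ` i ` carrier A"
    using inG_i u by (simp_all add: image_image)
  obtain r2 where r2: "r2 \<in> LO X" "rG \<subseteq> inv_image r2 inG" "rH \<subseteq> inv_image r2 inH"
      "is_min_positive X r2 ?z2" "stepping X r2 (inG ` i ` carrier A)"
    and unique2: "\<And>R'. R' \<in> LO X \<Longrightarrow> rG \<subseteq> inv_image R' inG \<Longrightarrow> rH \<subseteq> inv_image R' inH \<Longrightarrow>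
      (\<one>\<^bsub>X\<^esub>, ?z2) \<in> R' \<Longrightarrow> R' = r2"
    using amalgam.ex_unique_amalgam_order[OF amalgHG] unfolding swap by metis
  have rA_eq: "Restr (inv_image rG i) (carrier A) = Restr (inv_image rH j) (carrier A)"
    using assms(10,11) by simp
  have closed: "\<And>a. a \<in> carrier A \<Longrightarrow> i a \<in> carrier G" "\<And>a. a \<in> carrier A \<Longrightarrow> j a \<in> carrier H"
    using hom by (auto simp: hom_def)
  have pos: "(\<one>\<^bsub>X\<^esub>, ?z1) \<in> r1" "(\<one>\<^bsub>X\<^esub>, ?z2) \<in> r2"
    using r1(4) r2(4) by (simp_all add: is_min_positive_def)
  \<comment> \<open>The factors are not exchanged here: for both orders \<open>G\<close> has the
    absolute and \<open>H\<close> the relative characteristic set.\<close>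
  note char_set = amalgam_characteristic_set[OF grp X inG inH closed inG_i assms(6,8) rA_eq]
  have char1: "characteristic_positive_set X r1 (inG ` P \<union> inH ` Q \<union> {?z1})"
    and char2: "characteristic_positive_set X r2 (inG ` P \<union> inH ` Q \<union> {?z2})"
    if "characteristic_positive_set G rG P"
      "relative_characteristic_positive_set H (j ` carrier A) rH Q" for P Q
    by (rule char_set[OF _ _ _ r1(1-3) pos(1) unique1 that]; assumption)
      (rule char_set[OF _ _ _ r2(1-3) pos(2) unique2 that]; assumption)
  \<comment> \<open>The isolation hypotheses supply one such pair, from which isolation of both new
    orders follows.\<close>
  obtain P Q where "characteristic_positive_set G rG P"
      "relative_characteristic_positive_set H (j ` carrier A) rH Q"
    using assms(14,15) isolated_ordering_iff relatively_isolated_ordering_imp by metis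
  then have "isolated_ordering X r1" "isolated_ordering X r2"
    unfolding isolated_ordering_iff using char1 char2 by blast+
  moreover have "\<forall>g g'. (g, g') \<in> rG \<longrightarrow> (inG g, inG g') \<in> r1 \<and> (inG g, inG g') \<in> r2"
    using r1(2) r2(2) by (auto simp: subset_iff)
  moreover have "\<forall>h h'. (h, h') \<in> rH \<longrightarrow> (inH h, inH h') \<in> r1 \<and> (inH h, inH h') \<in> r2"
    using r1(3) r2(3) by (auto simp: subset_iff)
  ultimately show ?thesis
    using char1 char2 r1(1,4,5) r2(1,4,5)
    by (intro bexI[of _ r1] bexI[of _ r2] conjI allI impI) auto
qed

end
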